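(* Let $\varphi=(\varphi_n)_{n\ge0}$ be the competition interface defined in the context. Then, identifying $\mathbb{R}^2$ with $\mathbb{C}$ (so that $e^{i\alpha}=(\cos\alpha,\sin\alpha)$), $$\lim_{n\to\infty}\frac{\varphi_n}{|\varphi_n|}=e^{i\theta}\qquad \mathbb{P}\text{-a.s.},$$ where $\theta=\theta(\mathcal W)$ is a random angle in $[0,90^\circ]$ whose law is given by $$\mathbb{P}(\theta\le\alpha)=\frac{\sqrt{\sin\alpha}}{\sqrt{\sin\alpha}+\sqrt{\cos\alpha}},\qquad \alpha\in[0,90^\circ].$$
   Context: Let $\mathcal W=(w(z),z\in\mathbb{Z}^2)$ be i.i.d. exponential random variables of mean 1, with law $\mathbb{P}$. For $z=(i,j)$, $z'=(i',j')$ with $i\le i'$, $j\le j'$, an up/right path from $z$ to $z'$ is a sequence $z_1=z,\dots,z_n=z'$ with $z_{k+1}-z_k\in\{(1,0),(0,1)\}$; let $G(z,z')=\max_\pi\sum_{z''\in\pi}w(z'')$, the maximum over up/right paths $\pi$ from $z$ to $z'$ (endpoints included). Write $\mathbb{Z}^+=\{1,2,\dots\}$, and for $z\in(\mathbb{Z}^+)^2$ let $G(z)=G((1,1),z)$; set $G(i,j)=0$ if $i=0$ or $j=0$. The competition interface is defined by $\varphi_0=(1,1)$ and, for $n\ge0$, $\varphi_{n+1}=\arg\min\{G(\varphi_n+(1,0)),G(\varphi_n+(0,1))\}$ (i.e. $\varphi_{n+1}$ is whichever of $\varphi_n+(1,0)$, $\varphi_n+(0,1)$ has smaller value of $G$;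 ties have probability zero). $|\cdot|$ is the Euclidean norm. *)

theory Defs
  imports "HOL-Probability.Probability"
begin

definition up_right_path :: "int \<times> int \<Rightarrow> int \<times> int \<Rightarrow> (int \<times> int) list \<Rightarrow> bool" where
  "up_right_path z z' p \<longleftrightarrow> p \<noteq> [] \<and> hd p = z \<and> last p = z' \<and>
     (\<forall>k. Suc k < length p \<longrightarrow> p ! Suc k - p ! k \<in> {(1, 0), (0, 1)})"

definition lpp :: "(int \<times> int \<Rightarrow> real) \<Rightarrow> int \<times> int \<Rightarrow> int \<times> int \<Rightarrow> real" where
  "lpp w z z' = Max {sum_list (map w p) | p. up_right_path z z' p}"

definition G :: "(int \<times> int \<Rightarrow> real) \<Rightarrow> int \<times> int \<Rightarrow> real" where
  "G w z = (if fst z \<le> 0 \<or> snd z \<le> 0 then 0 else lpp w (1, 1) z)"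

(* competition interface; ties (probability zero) are broken towards (1,0) *)
fun comp_interface :: "(int \<times> int \<Rightarrow> real) \<Rightarrow> nat \<Rightarrow> int \<times> int" where
  "comp_interface w 0 = (1, 1)"
| "comp_interface w (Suc n) =
     (let a = comp_interface w n + (1, 0); b = comp_interface w n + (0, 1)
      in if G w a \<le> G w b then a else b)"

definition to_complex :: "int \<times> int \<Rightarrow> complex" where
  "to_complex z = Complex (real_of_int (fst z)) (real_of_int (snd z))"

end

theory Submission
  imports Defs
begin

text \<open>
  Passage times to the corner of a large box with suitable exponential boundary weights form a field \<open>B\<close> whose
  horizontal and vertical increments are i.i.d. Exp(\<open>\<rho>\<close>) and Exp(\<open>1 - \<rho>\<close>) along down-right paths (Burke's
  property). If \<open>B (1, 2) \<le> B (2, 1)\<close>, the greedy path of \<open>B\<close> starts to the right and, being a geodesic, can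
  never cross the competition interface. If moreover the interface visits the cone below slope \<open>s\<close> at a late time,
  so does this geodesic, and its passage time is an increment of \<open>B\<close>; it is also at most the corresponding increment
  of the field with parameter \<open>\<sigma> = 1 / (1 + sqrt s)\<close>. For \<open>\<rho> < \<sigma>\<close> the means of these increments are in the opposite
  order with a linear gap, so by Chernoff bounds this happens only finitely often. Hence the interface is below slope
  \<open>s\<close> infinitely often with probability at most \<open>P (B (2, 1) < B (1, 2)) = 1 - \<rho>\<close>, and \<open>\<rho> \<rightarrow> \<sigma>\<close> gives the bound
  \<open>sqrt s / (1 + sqrt s)\<close>. Reflection in the diagonal bounds the probability of being above slope \<open>s\<close> infinitely
  often by the complementary value. So the lower and the upper limit of the angle, which are ordered, have the
  same law, and therefore coincide almost surely.
\<close>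

section \<open>Resampling the minimum of two exponential variables\<close>

text \<open>The value of \<open>\<sigma>\<close> minimises a mean: an increment over
  \<open>a\<close> steps right and \<open>b\<close> steps up has mean
  \<open>a / r + b / (1 - r)\<close>, and for \<open>b = s * a\<close> this is smallest at
  \<open>r = 1 / (1 + sqrt s)\<close>. Any other parameter gives a larger mean, by an amount
  quadratic in \<open>\<sigma> - \<rho>\<close> and linear in \<open>a\<close>. A true Busemann
  function lives in infinite volume; its construction is avoided by letting a finite field end at a
  far corner. That corner must lie beyond all times considered, so times are cut into windows
  \<open>N0 \<le> n < N1\<close> with one box for each window. A wrong first step of the greedy path
  is one event for the whole window, so its probability \<open>1 - \<rho>\<close> is paid once, and
  the deviation errors are bounded by the tail of a summable series. Neither bound depends on the
  size of the box, so \<open>N1\<close> can tend to infinity with \<open>N0\<close> fixed. Both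
  fields use the same weights inside the box. They therefore solve the same recursion for each
  outcome, which makes the comparison of the geodesic of one field with the increments of the other
  a pathwise statement.\<close>

abbreviation expM :: "real \<Rightarrow> real measure" where
  "expM l \<equiv> density lborel (\<lambda>x. ennreal (exponential_density l x))"

text \<open>The density of \<open>X - Y\<close> for independent \<open>X\<close>, \<open>Y\<close>
  with laws Exp(\<open>\<rho>\<close>) and Exp(\<open>1 - \<rho>\<close>), an asymmetric Laplace
  law.\<close>

definition diff_density :: "real \<Rightarrow> real \<Rightarrow> real" where
  "diff_density \<rho> d = \<rho> * (1 - \<rho>) * (if 0 \<le> d then exp (- \<rho> * d) else exp ((1 - \<rho>) * d))"

lemma diff_density_measurable [measurable]: "diff_density \<rho> \<in> borel_measurable borel"
  unfolding diff_density_def by measurable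

lemma nn_integral_lborel_translate:
  fixes f :: "real \<Rightarrow> ennreal"
  assumes [measurable]: "f \<in> borel_measurable borel"
  shows "(\<integral>\<^sup>+x. f x \<partial>lborel) = (\<integral>\<^sup>+x. f (t + x) \<partial>lborel)"
  using nn_integral_real_affine[of f 1 t] by simp

lemma nn_integral_expM:
  assumes "f \<in> borel_measurable borel"
  shows "(\<integral>\<^sup>+x. f x \<partial>expM l) = (\<integral>\<^sup>+x. ennreal (exponential_density l x) * f x \<partial>lborel)"
  using assms by (subst nn_integral_density) auto

text \<open>In the coordinates minimum and difference the joint density factorises. The minimum has
  rate 1 because the two rates add up to 1.\<close>

lemma nn_integral_min_diff:
  fixes H :: "real \<Rightarrow> real \<Rightarrow> ennreal"
  assumes H[measurable]: "case_prod H \<in> borel_measurable (borel \<Otimes>\<^sub>M borel)"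
    and \<rho>: "0 < \<rho>" "\<rho> < 1"
  shows "(\<integral>\<^sup>+x. \<integral>\<^sup>+y. H (min x y) (x - y) \<partial>expM (1 - \<rho>) \<partial>expM \<rho>) =
         (\<integral>\<^sup>+d. ennreal (diff_density \<rho> d) * (\<integral>\<^sup>+v. H v d \<partial>expM 1) \<partial>lborel)"
proof -
  let ?e = "\<lambda>l x. ennreal (exponential_density l x)"
  have split: "?e \<rho> (y + d) * ?e (1 - \<rho>) y = ennreal (diff_density \<rho> d) * ?e 1 y" if "0 \<le> d" for y d
    using that \<rho> by (auto simp: exponential_density_def diff_density_def simp flip: ennreal_mult' exp_add) (auto simp: field_simps exp_add simp flip: exp_add)
  have split': "?e \<rho> v * ?e (1 - \<rho>) (v - d) = ennreal (diff_density \<rho> d) * ?e 1 v" if "d < 0" for v d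
    using that \<rho> by (auto simp: exponential_density_def diff_density_def simp flip: ennreal_mult' exp_add) (auto simp: field_simps exp_add simp flip: exp_add)
  have inner: "(\<integral>\<^sup>+y. ?e \<rho> (y + d) * ?e (1 - \<rho>) y * H (min (y + d) y) d \<partial>lborel) =
      (\<integral>\<^sup>+v. ennreal (diff_density \<rho> d) * ?e 1 v * H v d \<partial>lborel)" for d
  proof (cases "0 \<le> d")
    case True
    then have "min (y + d) y = y" for y by simp
    then show ?thesis using split[OF True] by simp
  next
    case False
    \<comment> \<open>For negative \<open>d\<close> the minimum is \<open>y + d\<close>; the
      translation makes it the integration variable \<open>v\<close>.\<close>
    have "(\<integral>\<^sup>+y. ?e \<rho> (y + d) * ?e (1 - \<rho>) y * H (min (y + d) y) d \<partial>lborel) =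
      (\<integral>\<^sup>+v. ?e \<rho> (- d + v + d) * ?e (1 - \<rho>) (- d + v) * H (min (- d + v + d) (- d + v)) d \<partial>lborel)"
      by (rule nn_integral_lborel_translate) measurable
    also have "\<dots> = (\<integral>\<^sup>+v. ?e \<rho> v * ?e (1 - \<rho>) (v - d) * H v d \<partial>lborel)"
      using False by (intro nn_integral_cong) (simp add: min_def)
    finally show ?thesis using split'[of d] False by simp
  qed
  have "(\<integral>\<^sup>+x. \<integral>\<^sup>+y. H (min x y) (x - y) \<partial>expM (1 - \<rho>) \<partial>expM \<rho>) =
      (\<integral>\<^sup>+x. \<integral>\<^sup>+y. ?e \<rho> x * ?e (1 - \<rho>) y * H (min x y) (x - y) \<partial>lborel \<partial>lborel)"
    by (simp add: nn_integral_expM nn_integral_cmult[symmetric] mult.assoc)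
  also have "\<dots> = (\<integral>\<^sup>+y. \<integral>\<^sup>+x. ?e \<rho> x * ?e (1 - \<rho>) y * H (min x y) (x - y) \<partial>lborel \<partial>lborel)"
    by (rule lborel_pair.Fubini') measurable
  also have "\<dots> = (\<integral>\<^sup>+y. \<integral>\<^sup>+d. ?e \<rho> (y + d) * ?e (1 - \<rho>) y * H (min (y + d) y) (y + d - y) \<partial>lborel \<partial>lborel)"
    by (intro nn_integral_cong nn_integral_lborel_translate) measurable
  also have "\<dots> = (\<integral>\<^sup>+d. \<integral>\<^sup>+y. ?e \<rho> (y + d) * ?e (1 - \<rho>) y * H (min (y + d) y) d \<partial>lborel \<partial>lborel)"
    by (subst lborel_pair.Fubini') simp_all
  also have "\<dots> = (\<integral>\<^sup>+d. ennreal (diff_density \<rho> d) * (\<integral>\<^sup>+v. H v d \<partial>expM 1) \<partial>lborel)"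
    unfolding inner by (simp add: nn_integral_expM nn_integral_cmult[symmetric] mult.assoc)
  finally show ?thesis .
qed

lemma prob_space_expM: "0 < l \<Longrightarrow> prob_space (expM l)"
  by (rule prob_space_exponential_density)

lemma sigma_finite_expM: "0 < l \<Longrightarrow> sigma_finite_measure (expM l)"
  by (intro finite_measure.sigma_finite_measure prob_space.finite_measure prob_space_expM)

text \<open>The local Burke property: an Exp(\<open>\<rho>\<close>) and an Exp(\<open>1 - \<rho>\<close>) variable have the same joint law
  after their minimum, which is Exp(1) and independent of their difference, is resampled.\<close>

lemma nn_integral_resample_min:
  fixes F :: "real \<Rightarrow> real \<Rightarrow> ennreal"
  assumes F[measurable]: "case_prod F \<in> borel_measurable (borel \<Otimes>\<^sub>M borel)"
    and \<rho>: "0 < \<rho>" "\<rho> < 1"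
  shows "(\<integral>\<^sup>+v. \<integral>\<^sup>+x. \<integral>\<^sup>+y. F (v + max 0 (x - y)) (v + max 0 (y - x)) \<partial>expM (1 - \<rho>) \<partial>expM \<rho> \<partial>expM 1)
    = (\<integral>\<^sup>+x. \<integral>\<^sup>+y. F x y \<partial>expM (1 - \<rho>) \<partial>expM \<rho>)"
proof -
  \<comment> \<open>\<open>H\<close> is \<open>F\<close> written in the coordinates minimum and
    difference. Resampling keeps the difference and inserts a fresh \<open>v\<close> for the
    minimum.\<close>
  define H where "H v d = F (v + max 0 d) (v + max 0 (- d))" for v d
  have H[measurable]: "case_prod H \<in> borel_measurable (borel \<Otimes>\<^sub>M borel)"
    unfolding H_def by measurable
  interpret one: prob_space "expM 1" by (rule prob_space_expM) simp
  have *: "F x y = H (min x y) (x - y)" for x y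
    by (auto simp: H_def min_def max_def)
  have "(\<integral>\<^sup>+v. \<integral>\<^sup>+x. \<integral>\<^sup>+y. F (v + max 0 (x - y)) (v + max 0 (y - x)) \<partial>expM (1 - \<rho>) \<partial>expM \<rho> \<partial>expM 1)
     = (\<integral>\<^sup>+v. \<integral>\<^sup>+d. ennreal (diff_density \<rho> d) * H v d \<partial>lborel \<partial>expM 1)"
  proof (rule nn_integral_cong)
    fix v
    \<comment> \<open>Applied to a function that ignores the minimum,
      \<open>nn_integral_min_diff\<close> gives the law of the difference alone.\<close>
    have "(\<integral>\<^sup>+x. \<integral>\<^sup>+y. H v (x - y) \<partial>expM (1 - \<rho>) \<partial>expM \<rho>) =
         (\<integral>\<^sup>+d. ennreal (diff_density \<rho> d) * (\<integral>\<^sup>+u. H v d \<partial>expM 1) \<partial>lborel)"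
      by (rule nn_integral_min_diff[where H="\<lambda>_. H v"]) (use \<rho> in auto)
    moreover have "(\<integral>\<^sup>+u. H v d \<partial>expM 1) = H v d" for d
      using one.emeasure_space_1 by simp
    ultimately show "(\<integral>\<^sup>+x. \<integral>\<^sup>+y. F (v + max 0 (x - y)) (v + max 0 (y - x)) \<partial>expM (1 - \<rho>) \<partial>expM \<rho>)
      = (\<integral>\<^sup>+d. ennreal (diff_density \<rho> d) * H v d \<partial>lborel)"
      by (simp add: H_def)
  qed
  also have "\<dots> = (\<integral>\<^sup>+d. \<integral>\<^sup>+v. ennreal (diff_density \<rho> d) * H v d \<partial>expM 1 \<partial>lborel)"
  proof -
    interpret P: pair_sigma_finite lborel "expM 1" ..
    show ?thesis by (rule P.Fubini') measurable
  qed
  also have "\<dots> = (\<integral>\<^sup>+d. ennreal (diff_density \<rho> d) * (\<integral>\<^sup>+v. H v d \<partial>expM 1) \<partial>lborel)"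
    by (simp add: nn_integral_cmult)
  also have "\<dots> = (\<integral>\<^sup>+x. \<integral>\<^sup>+y. F x y \<partial>expM (1 - \<rho>) \<partial>expM \<rho>)"
    unfolding * by (rule nn_integral_min_diff[symmetric]) (use \<rho> in auto)
  finally show ?thesis .
qed

lemma distr_resample_min:
  assumes \<rho>: "0 < \<rho>" "\<rho> < 1"
  shows "distr (expM 1 \<Otimes>\<^sub>M (expM \<rho> \<Otimes>\<^sub>M expM (1 - \<rho>))) (borel \<Otimes>\<^sub>M borel)
       (\<lambda>(v, x, y). (v + max 0 (x - y), v + max 0 (y - x))) = expM \<rho> \<Otimes>\<^sub>M expM (1 - \<rho>)"
proof (rule measure_eqI)
  interpret A: sigma_finite_measure "expM \<rho>" by (rule sigma_finite_expM) fact
  interpret B: sigma_finite_measure "expM (1 - \<rho>)" by (rule sigma_finite_expM) (use \<rho> in simp)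
  interpret AB: pair_sigma_finite "expM \<rho>" "expM (1 - \<rho>)" ..
  let ?D = "distr (expM 1 \<Otimes>\<^sub>M (expM \<rho> \<Otimes>\<^sub>M expM (1 - \<rho>))) (borel \<Otimes>\<^sub>M borel)
       (\<lambda>(v, x, y). (v + max 0 (x - y), v + max 0 (y - x)))"
  have sets_eq: "sets (expM a \<Otimes>\<^sub>M expM b) = sets (borel \<Otimes>\<^sub>M borel)" for a b
    by (intro sets_pair_measure_cong) auto
  show "sets ?D = sets (expM \<rho> \<Otimes>\<^sub>M expM (1 - \<rho>))" by (simp add: sets_eq)
  fix S assume "S \<in> sets ?D"
  then have S[measurable]: "S \<in> sets (borel \<Otimes>\<^sub>M borel)" by simp
  have m: "(\<lambda>(v, x, y). (v + max 0 (x - y), v + max 0 (y - x)))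
     \<in> measurable (expM 1 \<Otimes>\<^sub>M (expM \<rho> \<Otimes>\<^sub>M expM (1 - \<rho>))) (borel \<Otimes>\<^sub>M (borel :: real measure))"
    by measurable
  have m': "(\<lambda>(x, y). (v + max 0 (x - y), v + max 0 (y - x)))
     \<in> measurable (expM \<rho> \<Otimes>\<^sub>M expM (1 - \<rho>)) (borel \<Otimes>\<^sub>M (borel :: real measure))" for v
    by measurable
  have "emeasure ?D S = (\<integral>\<^sup>+p. indicator S p \<partial>?D)" using S by simp
  also have "\<dots> = (\<integral>\<^sup>+p. indicator S (case p of (v, x, y) \<Rightarrow> (v + max 0 (x - y), v + max 0 (y - x)))
      \<partial>(expM 1 \<Otimes>\<^sub>M (expM \<rho> \<Otimes>\<^sub>M expM (1 - \<rho>))))"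
    by (subst nn_integral_distr[OF m]) auto
  also have "\<dots> = (\<integral>\<^sup>+v. \<integral>\<^sup>+q. indicator S (case q of (x, y) \<Rightarrow> (v + max 0 (x - y), v + max 0 (y - x)))
      \<partial>(expM \<rho> \<Otimes>\<^sub>M expM (1 - \<rho>)) \<partial>expM 1)"
    by (subst sigma_finite_measure.nn_integral_fst[OF AB.P.sigma_finite_measure_axioms, symmetric,
          OF measurable_compose[OF m borel_measurable_indicator[OF S]]]) simp
  also have "\<dots> = (\<integral>\<^sup>+v. \<integral>\<^sup>+x. \<integral>\<^sup>+y. indicator S (v + max 0 (x - y), v + max 0 (y - x))
      \<partial>expM (1 - \<rho>) \<partial>expM \<rho> \<partial>expM 1)"
    by (subst B.nn_integral_fst[symmetric, OF measurable_compose[OF m' borel_measurable_indicator[OF S]]]) simp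
  also have "\<dots> = (\<integral>\<^sup>+x. \<integral>\<^sup>+y. indicator S (x, y) \<partial>expM (1 - \<rho>) \<partial>expM \<rho>)"
    by (rule nn_integral_resample_min[where F="\<lambda>x y. indicator S (x, y)"]) (use \<rho> in auto)
  also have "\<dots> = (\<integral>\<^sup>+q. indicator S q \<partial>(expM \<rho> \<Otimes>\<^sub>M expM (1 - \<rho>)))"
    by (rule B.nn_integral_fst) (simp add: sets_eq cong: measurable_cong_sets)
  also have "\<dots> = emeasure (expM \<rho> \<Otimes>\<^sub>M expM (1 - \<rho>)) S"
    by (rule nn_integral_indicator) (simp add: sets_eq)
  finally show "emeasure ?D S = emeasure (expM \<rho> \<Otimes>\<^sub>M expM (1 - \<rho>)) S" .
qed

section \<open>Exponential families: resampling and deviations\<close>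

lemma (in prob_space) indep_var_of_indep_vars:
  assumes "indep_vars (\<lambda>_. borel) X I" "b \<in> I" "c \<in> I" "b \<noteq> c"
  shows "indep_var borel (X b :: 'a \<Rightarrow> real) borel (X c)"
proof -
  have "indep_var borel ((\<lambda>f. f b) \<circ> (\<lambda>\<omega>. restrict (\<lambda>i. X i \<omega>) {b}))
      borel ((\<lambda>f. f c) \<circ> (\<lambda>\<omega>. restrict (\<lambda>i. X i \<omega>) {c}))"
    by (rule indep_var_compose[OF indep_var_restrict[OF assms(1)]]) (use assms in auto)
  then show ?thesis by (simp add: comp_def)
qed

lemma (in prob_space) distr_resample_pair:
  fixes X :: "'i \<Rightarrow> 'a \<Rightarrow> real"
  assumes ind: "indep_vars (\<lambda>_. borel) X I" and I: "{a, b, c} \<subseteq> I" "a \<noteq> b" "a \<noteq> c" "b \<noteq> c"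
    and \<rho>: "0 < \<rho>" "\<rho> < 1"
    and law: "distr M borel (X a) = expM 1" "distr M borel (X b) = expM \<rho>" "distr M borel (X c) = expM (1 - \<rho>)"
  defines "U \<equiv> \<lambda>\<omega>. X a \<omega> + max 0 (X b \<omega> - X c \<omega>)" and "V \<equiv> \<lambda>\<omega>. X a \<omega> + max 0 (X c \<omega> - X b \<omega>)"
  shows "indep_var borel U borel V" "distr M borel U = expM \<rho>" "distr M borel V = expM (1 - \<rho>)"
proof -
  have rv[measurable]: "X a \<in> borel_measurable M" "X b \<in> borel_measurable M" "X c \<in> borel_measurable M"
    using ind I by (auto simp: indep_vars_def)
  have rvU[measurable]: "U \<in> borel_measurable M" and rvV[measurable]: "V \<in> borel_measurable M"
    unfolding U_def V_def by measurable
  have "indep_var borel (X b) borel (X c)"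
    by (rule indep_var_of_indep_vars[OF ind]) (use I in auto)
  then have bc: "distr M (borel \<Otimes>\<^sub>M borel) (\<lambda>\<omega>. (X b \<omega>, X c \<omega>)) = expM \<rho> \<Otimes>\<^sub>M expM (1 - \<rho>)"
    using law by (simp add: indep_var_distribution_eq)
  let ?P = "\<lambda>T. PiM T (\<lambda>_. borel) :: ('i \<Rightarrow> real) measure"
  let ?R = "\<lambda>T \<omega>. restrict (\<lambda>i. X i \<omega>) T"
  have R: "?R {a} \<in> measurable M (?P {a})" "?R {b, c} \<in> measurable M (?P {b, c})"
    by (auto intro!: measurable_restrict)
  have "indep_var (?P {a}) (?R {a}) (?P {b, c}) (?R {b, c})"
    by (rule indep_var_restrict[OF ind]) (use I in auto)
  then have joint: "distr M (?P {a}) (?R {a}) \<Otimes>\<^sub>M distr M (?P {b, c}) (?R {b, c}) =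
      distr M (?P {a} \<Otimes>\<^sub>M ?P {b, c}) (\<lambda>\<omega>. (?R {a} \<omega>, ?R {b, c} \<omega>))"
    by (simp add: indep_var_distribution_eq)
  have da: "distr (distr M (?P {a}) (?R {a})) borel (\<lambda>f. f a) = expM 1"
    using R law by (subst distr_distr) (auto simp: comp_def)
  have dbc: "distr (distr M (?P {b, c}) (?R {b, c})) (borel \<Otimes>\<^sub>M borel) (\<lambda>f. (f b, f c)) = expM \<rho> \<Otimes>\<^sub>M expM (1 - \<rho>)"
    using R bc by (subst distr_distr) (auto simp: comp_def)
  interpret A: prob_space "expM \<rho>" by (rule prob_space_expM) fact
  interpret B: prob_space "expM (1 - \<rho>)" by (rule prob_space_expM) (use \<rho> in simp)
  interpret AB: pair_prob_space "expM \<rho>" "expM (1 - \<rho>)" ..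
  \<comment> \<open>Both factors are written as images of laws of restricted families, so that the
    independence of the families \<open>{a}\<close> and \<open>{b, c}\<close> yields the joint law
    of the triple.\<close>
  have "expM 1 \<Otimes>\<^sub>M (expM \<rho> \<Otimes>\<^sub>M expM (1 - \<rho>)) =
      distr (distr M (?P {a}) (?R {a}) \<Otimes>\<^sub>M distr M (?P {b, c}) (?R {b, c})) (borel \<Otimes>\<^sub>M (borel \<Otimes>\<^sub>M borel))
        (\<lambda>(f, g). (f a, (g b, g c)))"
    unfolding da[symmetric] dbc[symmetric]
    by (rule pair_measure_distr) (auto simp: dbc AB.P.sigma_finite_measure_axioms)
  also have "\<dots> = distr M (borel \<Otimes>\<^sub>M (borel \<Otimes>\<^sub>M borel)) (\<lambda>\<omega>. (X a \<omega>, X b \<omega>, X c \<omega>))"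
    unfolding joint using R by (subst distr_distr) (auto simp: comp_def)
  finally have abc: "distr M (borel \<Otimes>\<^sub>M (borel \<Otimes>\<^sub>M borel)) (\<lambda>\<omega>. (X a \<omega>, X b \<omega>, X c \<omega>))
      = expM 1 \<Otimes>\<^sub>M (expM \<rho> \<Otimes>\<^sub>M expM (1 - \<rho>))" ..
  let ?f = "\<lambda>(v, x, y). (v + max 0 (x - y), v + max 0 (y - x)) :: real \<times> real"
  have f: "?f \<in> measurable (borel \<Otimes>\<^sub>M (borel \<Otimes>\<^sub>M borel)) (borel \<Otimes>\<^sub>M borel)" by measurable
  have "distr M (borel \<Otimes>\<^sub>M borel) (\<lambda>\<omega>. (U \<omega>, V \<omega>)) =
      distr (distr M (borel \<Otimes>\<^sub>M (borel \<Otimes>\<^sub>M borel)) (\<lambda>\<omega>. (X a \<omega>, X b \<omega>, X c \<omega>))) (borel \<Otimes>\<^sub>M borel) ?f"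
    by (subst distr_distr[OF f]) (auto simp: comp_def U_def V_def)
  also have "\<dots> = expM \<rho> \<Otimes>\<^sub>M expM (1 - \<rho>)"
    unfolding abc by (rule distr_resample_min[OF \<rho>])
  finally have UV: "distr M (borel \<Otimes>\<^sub>M borel) (\<lambda>\<omega>. (U \<omega>, V \<omega>)) = expM \<rho> \<Otimes>\<^sub>M expM (1 - \<rho>)" .
  have "distr M borel U = distr (distr M (borel \<Otimes>\<^sub>M borel) (\<lambda>\<omega>. (U \<omega>, V \<omega>))) borel fst"
    by (subst distr_distr) (auto simp: comp_def)
  also have "\<dots> = distr (expM \<rho> \<Otimes>\<^sub>M expM (1 - \<rho>)) (expM \<rho>) fst"
    unfolding UV by (intro distr_cong) auto
  also have "\<dots> = expM \<rho>" by (rule B.distr_pair_fst)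
  finally show U: "distr M borel U = expM \<rho>" .
  have "distr M borel V = distr (distr M (borel \<Otimes>\<^sub>M borel) (\<lambda>\<omega>. (U \<omega>, V \<omega>))) borel snd"
    by (subst distr_distr) (auto simp: comp_def)
  also have "\<dots> = distr (expM \<rho> \<Otimes>\<^sub>M expM (1 - \<rho>)) (expM (1 - \<rho>)) snd"
    unfolding UV by (intro distr_cong) auto
  also have "\<dots> = expM (1 - \<rho>)"
    by (subst AB.distr_pair_swap) (simp add: distr_distr comp_def case_prod_beta A.distr_pair_fst)
  finally show V: "distr M borel V = expM (1 - \<rho>)" .
  show "indep_var borel U borel V"
    using U V UV rvU rvV by (simp add: indep_var_distribution_eq)
qed

text \<open>\<open>U\<close> and \<open>V\<close> are functions of a triple independent of the rest,
  and they are independent of each other. The weight \<open>a\<close> is consumed: three variables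
  become two, and the index \<open>a\<close> leaves the family.\<close>

lemma (in prob_space) indep_vars_resample:
  fixes X :: "'i \<Rightarrow> 'a \<Rightarrow> real"
  assumes fin: "finite S" and ind: "indep_vars (\<lambda>_. borel) X (insert a (insert b (insert c S)))"
    and abc: "a \<noteq> b" "a \<noteq> c" "b \<noteq> c" "a \<notin> S" "b \<notin> S" "c \<notin> S"
    and \<rho>: "0 < \<rho>" "\<rho> < 1"
    and law: "distr M borel (X a) = expM 1" "distr M borel (X b) = expM \<rho>" "distr M borel (X c) = expM (1 - \<rho>)"
  defines "U \<equiv> \<lambda>\<omega>. X a \<omega> + max 0 (X b \<omega> - X c \<omega>)" and "V \<equiv> \<lambda>\<omega>. X a \<omega> + max 0 (X c \<omega> - X b \<omega>)"
  shows "indep_vars (\<lambda>_. borel) (X(b := U, c := V)) (insert b (insert c S))"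
proof -
  let ?Y = "X(b := U, c := V)"
  have rv: "i \<in> insert a (insert b (insert c S)) \<Longrightarrow> X i \<in> borel_measurable M" for i
    using ind by (auto simp: indep_vars_def)
  have [measurable]: "X a \<in> borel_measurable M" "X b \<in> borel_measurable M" "X c \<in> borel_measurable M"
    using rv by auto
  have [measurable]: "U \<in> borel_measurable M" "V \<in> borel_measurable M"
    unfolding U_def V_def by measurable
  have UV: "indep_var borel U borel V"
    unfolding U_def V_def by (rule distr_resample_pair(1)[OF ind _ abc(1-3) \<rho> law]) auto
  have rvY: "i \<in> insert b (insert c S) \<Longrightarrow> ?Y i \<in> borel_measurable M" for i
    using rv by auto
  have "prob (\<Inter>j\<in>insert b (insert c S). ?Y j -` A j \<inter> space M)
      = (\<Prod>j\<in>insert b (insert c S). prob (?Y j -` A j \<inter> space M))"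
    if A: "A \<in> (\<Pi> i\<in>insert b (insert c S). sets borel)" for A
  proof -
    have [measurable]: "A b \<in> sets borel" "A c \<in> sets borel" using A by auto
    let ?f = "\<lambda>f. (f a + max 0 (f b - f c), f a + max 0 (f c - f b)) :: real \<times> real"
    let ?P = "\<lambda>T. PiM T (\<lambda>_. borel) :: ('i \<Rightarrow> real) measure"
    let ?R = "\<lambda>T \<omega>. restrict (\<lambda>i. X i \<omega>) T"
    have f: "?f \<in> measurable (?P {a, b, c}) (borel \<Otimes>\<^sub>M borel)" by measurable
    have 1: "indep_var (?P {a, b, c}) (?R {a, b, c}) (?P S) (?R S)"
      by (rule indep_var_restrict[OF ind]) (use abc in auto)
    have 2: "?f -` (A b \<times> A c) \<inter> space (?P {a, b, c}) \<in> sets (?P {a, b, c})"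
      by (rule measurable_sets[OF f]) auto
    have 3: "Pi\<^sub>E S A \<in> sets (?P S)"
      using A fin by (intro sets_PiM_I_finite) auto
    have S: "?R S -` Pi\<^sub>E S A \<inter> space M = {\<omega> \<in> space M. \<forall>i\<in>S. X i \<omega> \<in> A i}"
      by (auto simp: PiE_iff)
    have pS: "prob (?R S -` Pi\<^sub>E S A \<inter> space M) = (\<Prod>i\<in>S. prob (X i -` A i \<inter> space M))"
    proof (cases "S = {}")
      case True then show ?thesis unfolding S by (simp add: prob_space)
    next
      case False
      have "?R S -` Pi\<^sub>E S A \<inter> space M = (\<Inter>i\<in>S. X i -` A i \<inter> space M)"
        using False unfolding S by auto
      moreover have "prob (\<Inter>i\<in>S. X i -` A i \<inter> space M) = (\<Prod>i\<in>S. prob (X i -` A i \<inter> space M))"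
        by (rule indep_varsD[OF ind False fin]) (use A in auto)
      ultimately show ?thesis by simp
    qed
    define Q where "Q = ?f -` (A b \<times> A c) \<inter> space (?P {a, b, c})"
    have Q: "?R {a, b, c} \<omega> \<in> Q \<longleftrightarrow> U \<omega> \<in> A b \<and> V \<omega> \<in> A c" for \<omega>
    proof -
      have "?R {a, b, c} \<omega> \<in> space (?P {a, b, c})" by (simp add: space_PiM)
      then show ?thesis using abc by (simp add: Q_def U_def V_def)
    qed
    have R: "?R S \<omega> \<in> Pi\<^sub>E S A \<longleftrightarrow> (\<forall>i\<in>S. X i \<omega> \<in> A i)" for \<omega>
      by (simp add: PiE_iff)
    have "(\<Inter>j\<in>insert b (insert c S). ?Y j -` A j \<inter> space M) =
        {\<omega> \<in> space M. U \<omega> \<in> A b \<and> V \<omega> \<in> A c \<and> (\<forall>i\<in>S. X i \<omega> \<in> A i)}"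
      using abc by (auto split: if_splits)
    also have "\<dots> = (\<lambda>\<omega>. (?R {a, b, c} \<omega>, ?R S \<omega>)) -` (Q \<times> Pi\<^sub>E S A) \<inter> space M"
      by (rule set_eqI) (simp only: Q R Int_iff vimage_eq mem_Times_iff fst_conv snd_conv mem_Collect_eq, blast)
    also have "prob \<dots> = prob (?R {a, b, c} -` Q \<inter> space M) *
        prob (?R S -` Pi\<^sub>E S A \<inter> space M)"
      unfolding Q_def by (rule indep_varD[OF 1 2 3])
    also have "?R {a, b, c} -` Q \<inter> space M = (\<lambda>\<omega>. (U \<omega>, V \<omega>)) -` (A b \<times> A c) \<inter> space M"
      by (rule set_eqI) (simp only: Q Int_iff vimage_eq mem_Times_iff fst_conv snd_conv)
    also have "prob \<dots> = prob (U -` A b \<inter> space M) * prob (V -` A c \<inter> space M)"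
      by (rule indep_varD[OF UV]) auto
    also have "\<dots> * prob (?R S -` Pi\<^sub>E S A \<inter> space M) = 
        (\<Prod>j\<in>insert b (insert c S). prob (?Y j -` A j \<inter> space M))"
    proof -
      have "(\<Prod>i\<in>S. prob (X i -` A i \<inter> space M)) = (\<Prod>j\<in>S. prob (?Y j -` A j \<inter> space M))"
        using abc by (intro prod.cong) auto
      then show ?thesis unfolding pS using abc fin by (simp add: ac_simps)
    qed
    finally show ?thesis .
  qed
  then show ?thesis
    using fin rvY
    by (subst indep_vars_finite[where E="\<lambda>_. sets borel"])
       (auto simp: Int_stable_def sets.sigma_sets_eq[of borel, simplified] simp del: fun_upd_apply)
qed

lemma (in prob_space) exp_density_mgf:
  fixes X :: "'a \<Rightarrow> real"
  assumes X: "X \<in> borel_measurable M" and law: "distr M borel X = expM l" and t: "t < l" and l: "0 < l"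
  shows "(\<integral>\<^sup>+\<omega>. ennreal (exp (t * X \<omega>)) \<partial>M) = ennreal (l / (l - t))"
proof -
  have "(\<integral>\<^sup>+\<omega>. ennreal (exp (t * X \<omega>)) \<partial>M) = (\<integral>\<^sup>+x. ennreal (exp (t * x)) \<partial>distr M borel X)"
    using X by (subst nn_integral_distr) auto
  also have "\<dots> = (\<integral>\<^sup>+x. ennreal (exponential_density l x) * ennreal (exp (t * x)) \<partial>lborel)"
    unfolding law by (rule nn_integral_expM) simp
  also have "\<dots> = (\<integral>\<^sup>+x. ennreal (l / (l - t)) * ennreal (exponential_density (l - t) x) \<partial>lborel)"
  proof (intro nn_integral_cong)
    fix x
    have "l * exp (- x * l) * exp (t * x) = l * exp (- x * (l - t))"
      by (simp add: algebra_simps flip: exp_add)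
    then show "ennreal (exponential_density l x) * ennreal (exp (t * x)) =
        ennreal (l / (l - t)) * ennreal (exponential_density (l - t) x)"
      using t l by (auto simp: exponential_density_def simp flip: ennreal_mult')
  qed
  also have "\<dots> = ennreal (l / (l - t)) * (\<integral>\<^sup>+x. 1 \<partial>expM (l - t))"
    by (simp only: nn_integral_cmult nn_integral_expM measurable_const borel_measurable_const mult_1_right)
       (simp add: nn_integral_cmult)
  also have "(\<integral>\<^sup>+x. 1 \<partial>expM (l - t)) = 1"
    using prob_space.emeasure_space_1[OF prob_space_expM[of "l - t"]] t by simp
  finally show ?thesis by simp
qed

text \<open>With \<open>u = t / l\<close> the left side is the moment generating function of
  Exp(\<open>l\<close>) at \<open>t\<close>; its logarithm is bounded by the mean term plus a
  quadratic error.\<close>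

lemma inverse_one_minus_le_exp:
  fixes u :: real
  assumes "\<bar>u\<bar> \<le> 1 / 2"
  shows "1 / (1 - u) \<le> exp (u + 2 * u\<^sup>2)"
proof -
  have "- u - 2 * u\<^sup>2 \<le> ln (1 + - u)"
    using abs_ln_one_plus_x_minus_x_bound[of "- u"] assms by (simp add: abs_le_iff)
  then have "exp (- u - 2 * u\<^sup>2) \<le> 1 - u"
    using assms by (simp add: ln_ge_iff)
  then have "1 / (1 - u) \<le> 1 / exp (- u - 2 * u\<^sup>2)"
    using assms by (intro divide_left_mono) auto
  also have "\<dots> = exp (u + 2 * u\<^sup>2)" by (simp add: exp_minus' [symmetric] exp_minus field_simps flip: exp_add)
  finally show ?thesis .
qed

text \<open>Markov's inequality for \<open>exp (t * sum)\<close>; the sign of \<open>t\<close>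
  selects the upper or the lower tail. Deviations are measured in \<open>n\<close> instead of
  \<open>card K\<close>, so that the bound decays in \<open>n\<close> even when \<open>K\<close> is
  small or empty.\<close>

lemma (in prob_space) exp_sum_chernoff:
  fixes X :: "'i \<Rightarrow> 'a \<Rightarrow> real"
  assumes K: "finite K" "card K \<le> n" and ind: "indep_vars (\<lambda>_. borel) X K"
    and law: "\<And>i. i \<in> K \<Longrightarrow> distr M borel (X i) = expM l" and l: "0 < l"
    and t: "\<bar>t\<bar> \<le> l / 2" "2 * \<bar>t\<bar> / l\<^sup>2 \<le> \<delta> / 2"
  shows "prob {\<omega> \<in> space M. \<bar>t\<bar> * (\<delta> * real n) \<le> t * ((\<Sum>i\<in>K. X i \<omega>) - real (card K) / l)}
      \<le> exp (- (\<bar>t\<bar> * \<delta> / 2) * real n)"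
proof -
  have [measurable]: "i \<in> K \<Longrightarrow> X i \<in> borel_measurable M" for i using ind by (auto simp: indep_vars_def)
  let ?k = "real (card K)"
  let ?Z = "\<lambda>\<omega>. exp (t * (\<Sum>i\<in>K. X i \<omega>))"
  let ?a = "\<bar>t\<bar> * \<delta> * n + t * ?k / l"
  let ?S = "{\<omega> \<in> space M. \<bar>t\<bar> * (\<delta> * real n) \<le> t * ((\<Sum>i\<in>K. X i \<omega>) - ?k / l)}"
  have u: "\<bar>t / l\<bar> \<le> 1 / 2" using t l by (simp add: field_simps)
  have tl: "t < l" using t l by auto
  have "0 \<le> 2 * \<bar>t\<bar> / l\<^sup>2" by simp
  then have \<delta>: "0 \<le> \<delta>" using t(2) by linarith
  have "(\<integral>\<^sup>+\<omega>. ennreal (?Z \<omega>) \<partial>M) = (\<integral>\<^sup>+\<omega>. (\<Prod>i\<in>K. ennreal (exp (t * X i \<omega>))) \<partial>M)"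
    using K by (simp add: sum_distrib_left exp_sum prod_ennreal)
  also have "\<dots> = (\<Prod>i\<in>K. \<integral>\<^sup>+\<omega>. ennreal (exp (t * X i \<omega>)) \<partial>M)"
    by (intro indep_vars_nn_integral K indep_vars_compose2[OF ind]) auto
  also have "\<dots> = (\<Prod>i\<in>K. ennreal (l / (l - t)))"
    using law tl l by (intro prod.cong exp_density_mgf) auto
  also have "\<dots> = ennreal ((1 / (1 - t / l)) ^ card K)"
    using l tl by (simp add: ennreal_power field_simps)
  also have "\<dots> \<le> ennreal (exp (t / l + 2 * (t / l)\<^sup>2) ^ card K)"
    using l tl by (intro ennreal_leI power_mono inverse_one_minus_le_exp u) (auto simp: field_simps)
  also have "exp (t / l + 2 * (t / l)\<^sup>2) ^ card K = exp (t * ?k / l + 2 * t\<^sup>2 / l\<^sup>2 * ?k)"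
    by (simp add: exp_of_nat_mult[symmetric] field_simps)
  finally have mgf: "(\<integral>\<^sup>+\<omega>. ennreal (?Z \<omega>) \<partial>M) \<le> ennreal (exp (t * ?k / l + 2 * t\<^sup>2 / l\<^sup>2 * ?k))" .
  have "emeasure M ?S \<le> (\<integral>\<^sup>+\<omega>. ennreal (exp (- ?a)) * ennreal (?Z \<omega>) \<partial>M)"
  proof -
    have "emeasure M ?S = (\<integral>\<^sup>+\<omega>. indicator ?S \<omega> \<partial>M)" by simp
    also have "\<dots> \<le> (\<integral>\<^sup>+\<omega>. ennreal (exp (- ?a)) * ennreal (?Z \<omega>) \<partial>M)"
      by (intro nn_integral_mono)
        (auto simp: indicator_def algebra_simps simp flip: ennreal_mult' exp_add ennreal_1)
    finally show ?thesis .
  qed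
  also have "\<dots> \<le> ennreal (exp (- ?a)) * ennreal (exp (t * ?k / l + 2 * t\<^sup>2 / l\<^sup>2 * ?k))"
    using mult_left_mono[OF mgf, of "ennreal (exp (- ?a))"] by (subst nn_integral_cmult) measurable
  also have "\<dots> = ennreal (exp (2 * t\<^sup>2 / l\<^sup>2 * ?k - \<bar>t\<bar> * \<delta> * n))"
    by (simp add: flip: ennreal_mult' exp_add)
  also have "\<dots> \<le> ennreal (exp (- (\<bar>t\<bar> * \<delta> / 2) * real n))"
  proof -
    \<comment> \<open>The second condition on \<open>t\<close> lets the quadratic error eat at most
      half of the linear gain.\<close>
    have "2 * t\<^sup>2 / l\<^sup>2 * ?k = \<bar>t\<bar> * ((2 * \<bar>t\<bar> / l\<^sup>2) * ?k)"
      by (simp add: power2_eq_square abs_mult_self_eq)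
    also have "\<dots> \<le> \<bar>t\<bar> * (\<delta> / 2 * real n)"
      using K t by (intro mult_left_mono mult_mono) (auto simp: \<delta>)
    finally show ?thesis by (simp add: algebra_simps)
  qed
  finally show ?thesis by (simp add: emeasure_eq_measure)
qed

section \<open>Burke's property\<close>

text \<open>Coordinates count from the far corner of the box, so the field grows with both
  arguments. Dividing boundary weights of rate 1 by \<open>\<rho>\<close> and
  \<open>1 - \<rho>\<close> lets one family of weights serve all parameters.\<close>

fun stat_lpp :: "(nat \<times> nat \<Rightarrow> real) \<Rightarrow> real \<Rightarrow> nat \<Rightarrow> nat \<Rightarrow> real" where
  "stat_lpp v \<rho> 0 0 = 0"
| "stat_lpp v \<rho> (Suc m) 0 = stat_lpp v \<rho> m 0 + v (Suc m, 0) / \<rho>"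
| "stat_lpp v \<rho> 0 (Suc n) = stat_lpp v \<rho> 0 n + v (0, Suc n) / (1 - \<rho>)"
| "stat_lpp v \<rho> (Suc m) (Suc n) =
     v (Suc m, Suc n) + max (stat_lpp v \<rho> m (Suc n)) (stat_lpp v \<rho> (Suc m) n)"

definition hinc :: "(nat \<times> nat \<Rightarrow> real) \<Rightarrow> real \<Rightarrow> nat \<Rightarrow> nat \<Rightarrow> real" where
  "hinc v \<rho> m n = stat_lpp v \<rho> (Suc m) n - stat_lpp v \<rho> m n"

definition vinc :: "(nat \<times> nat \<Rightarrow> real) \<Rightarrow> real \<Rightarrow> nat \<Rightarrow> nat \<Rightarrow> real" where
  "vinc v \<rho> m n = stat_lpp v \<rho> m (Suc n) - stat_lpp v \<rho> m n"

lemma hinc_0: "hinc v \<rho> m 0 = v (Suc m, 0) / \<rho>"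
  by (simp add: hinc_def)

lemma vinc_0: "vinc v \<rho> 0 n = v (0, Suc n) / (1 - \<rho>)"
  by (simp add: vinc_def)

lemma hinc_Suc: "hinc v \<rho> m (Suc n) = v (Suc m, Suc n) + max 0 (hinc v \<rho> m n - vinc v \<rho> m n)"
  by (simp add: hinc_def vinc_def)

lemma vinc_Suc: "vinc v \<rho> (Suc m) n = v (Suc m, Suc n) + max 0 (vinc v \<rho> m n - hinc v \<rho> m n)"
  by (simp add: hinc_def vinc_def)

lemma hinc_minus_vinc: "hinc v \<rho> m (Suc n) - vinc v \<rho> (Suc m) n = stat_lpp v \<rho> (Suc m) n - stat_lpp v \<rho> m (Suc n)"
  by (simp add: hinc_def vinc_def)

lemma stat_lpp_minus:
  assumes "a \<le> m" "b \<le> n"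
  shows "stat_lpp v \<rho> m n - stat_lpp v \<rho> a b = (\<Sum>i = a..<m. hinc v \<rho> i n) + (\<Sum>j = b..<n. vinc v \<rho> a j)"
  using assms sum_Suc_diff'[of a m "\<lambda>i. stat_lpp v \<rho> i n"] sum_Suc_diff'[of b n "\<lambda>j. stat_lpp v \<rho> a j"]
  by (simp add: hinc_def vinc_def)

text \<open>Increments across the boundary of the down-left region in which the columns before \<open>c\<close> have been
  filled to height \<open>N\<close> and column \<open>c\<close> to height \<open>k\<close>, together with the weights that are still unused.
  An increment is stored at the index of the boundary weight in its row or column.\<close>

definition stair :: "(nat \<times> nat \<Rightarrow> real) \<Rightarrow> real \<Rightarrow> nat \<Rightarrow> nat \<Rightarrow> nat \<Rightarrow> nat \<times> nat \<Rightarrow> real" where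
  "stair v \<rho> N c k z = (case z of
      (Suc i, 0) \<Rightarrow> hinc v \<rho> i (if i < c then N else if i = c then k else 0)
    | (0, Suc j) \<Rightarrow> vinc v \<rho> (if j < k then Suc c else c) j
    | _ \<Rightarrow> v z)"

definition stair_index :: "nat \<Rightarrow> nat \<Rightarrow> nat \<Rightarrow> (nat \<times> nat) set" where
  "stair_index N c k = (\<lambda>i. (Suc i, 0)) ` {..<N} \<union> (\<lambda>j. (0, Suc j)) ` {..<N} \<union>
     (\<lambda>(i, j). (Suc i, Suc j)) ` {(i, j). i < N \<and> j < N \<and> (c < i \<or> i = c \<and> k \<le> j)}"

definition stair_rate :: "real \<Rightarrow> nat \<times> nat \<Rightarrow> real" where
  "stair_rate \<rho> z = (if snd z = 0 then \<rho> else if fst z = 0 then 1 - \<rho> else 1)"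

lemma finite_stair_index: "finite (stair_index N c k)"
proof -
  have "stair_index N c k \<subseteq> {..N} \<times> {..N}" by (auto simp: stair_index_def)
  then show ?thesis by (rule finite_subset) simp
qed

text \<open>Filling one cell uses up its weight and rewrites the two increments of its column and
  row; all other indices stay.\<close>

lemma stair_index_Suc:
  assumes "c < N" "k < N"
  shows "stair_index N c k = insert (Suc c, Suc k) (insert (Suc c, 0) (insert (0, Suc k)
     (stair_index N c (Suc k) - {(Suc c, 0), (0, Suc k)})))"
    and "stair_index N c (Suc k) = insert (Suc c, 0) (insert (0, Suc k)
     (stair_index N c (Suc k) - {(Suc c, 0), (0, Suc k)}))"
  using assms by (auto simp: stair_index_def image_iff)

lemma stair_Suc:
  assumes "z \<in> stair_index N c (Suc k)"
  shows "stair v \<rho> N c (Suc k) z =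
     (if z = (Suc c, 0) then stair v \<rho> N c k (Suc c, Suc k) + max 0 (stair v \<rho> N c k (Suc c, 0) - stair v \<rho> N c k (0, Suc k))
      else if z = (0, Suc k) then stair v \<rho> N c k (Suc c, Suc k) + max 0 (stair v \<rho> N c k (0, Suc k) - stair v \<rho> N c k (Suc c, 0))
      else stair v \<rho> N c k z)"
  using assms by (auto simp: stair_index_def stair_def hinc_Suc vinc_Suc split: if_splits)

lemma stair_next_column:
  assumes "z \<in> stair_index N (Suc c) 0"
  shows "stair v \<rho> N c N z = stair v \<rho> N (Suc c) 0 z"
  using assms by (auto simp: stair_index_def stair_def)

lemma stair_index_next_column: "stair_index N c N = stair_index N (Suc c) 0"
  by (auto simp: stair_index_def image_iff)

lemma (in prob_space) distr_exp_scale: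
  assumes [measurable]: "X \<in> borel_measurable M" and law: "distr M borel X = expM 1" and l: "0 < l"
  shows "distr M borel (\<lambda>\<omega>. X \<omega> / l) = expM l"
proof -
  have "distributed M lborel X (\<lambda>x. ennreal (exponential_density 1 x))"
    using law by (simp add: distributed_def cong: distr_cong)
  from distributed_affine[OF this, of "1 / l" 0]
  have "distributed M lborel (\<lambda>\<omega>. X \<omega> / l) (\<lambda>x. ennreal (exponential_density 1 (x * l)) / ennreal (1 / l))"
    using l by simp
  moreover have "ennreal (exponential_density 1 (x * l)) / ennreal (1 / l) = ennreal (exponential_density l x)" for x
  proof -
    have "x * l < 0 \<longleftrightarrow> x < 0" using l by (simp add: mult_less_0_iff)
    then show ?thesis using l by (simp add: exponential_density_def divide_ennreal mult.commute)
  qed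
  ultimately have "distributed M lborel (\<lambda>\<omega>. X \<omega> / l) (\<lambda>x. ennreal (exponential_density l x))"
    by simp
  then show ?thesis by (simp add: distributed_def cong: distr_cong)
qed

text \<open>Cells are filled column by column, each from height 0 to \<open>N\<close>. Filling a
  cell replaces its weight and the increments on its lower and left sides by those on its upper and
  right sides, which is exactly the map of \<open>indep_vars_resample\<close>.\<close>

lemma (in prob_space) burke_staircase:
  fixes v :: "nat \<times> nat \<Rightarrow> 'a \<Rightarrow> real"
  assumes ind: "indep_vars (\<lambda>_. borel) v ({..N} \<times> {..N})"
    and law: "\<And>z. z \<in> {..N} \<times> {..N} \<Longrightarrow> distr M borel (v z) = expM 1"
    and \<rho>: "0 < \<rho>" "\<rho> < 1" and "c < N" "k \<le> N"
  shows "indep_vars (\<lambda>_. borel) (\<lambda>z \<omega>. stair (\<lambda>z. v z \<omega>) \<rho> N c k z) (stair_index N c k) \<and>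
    (\<forall>z\<in>stair_index N c k. distr M borel (\<lambda>\<omega>. stair (\<lambda>z. v z \<omega>) \<rho> N c k z) = expM (stair_rate \<rho> z))"
    (is "?P c k")
proof -
  let ?X = "\<lambda>c k z \<omega>. stair (\<lambda>z. v z \<omega>) \<rho> N c k z"
  have sub: "stair_index N c k \<subseteq> {..N} \<times> {..N}" for c k by (auto simp: stair_index_def)
  have start: "?P 0 0"
  proof
    \<comment> \<open>The initial staircase runs along the axes, so all its entries are rescaled
      original weights.\<close>
    have eq: "stair (\<lambda>z. v z \<omega>) \<rho> N 0 0 z = v z \<omega> / stair_rate \<rho> z" if "z \<in> stair_index N 0 0" for z \<omega>
      using that by (auto simp: stair_index_def stair_def stair_rate_def hinc_0 vinc_0)
    have "indep_vars (\<lambda>_. borel) (\<lambda>z \<omega>. v z \<omega> / stair_rate \<rho> z) (stair_index N 0 0)"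
      by (rule indep_vars_compose2[OF indep_vars_subset[OF ind sub]]) auto
    then show "indep_vars (\<lambda>_. borel) (?X 0 0) (stair_index N 0 0)"
      by (rule indep_vars_cong[THEN iffD1, rotated 3]) (auto simp: eq)
    have "distr M borel (\<lambda>\<omega>. v z \<omega> / stair_rate \<rho> z) = expM (stair_rate \<rho> z)" if "z \<in> stair_index N 0 0" for z
    proof (rule distr_exp_scale)
      show "v z \<in> borel_measurable M" using ind that sub[of 0 0] by (auto simp: indep_vars_def)
      show "distr M borel (v z) = expM 1" using law sub that by blast
      show "0 < stair_rate \<rho> z" using \<rho> by (simp add: stair_rate_def)
    qed
    then show "\<forall>z\<in>stair_index N 0 0. distr M borel (?X 0 0 z) = expM (stair_rate \<rho> z)"
      by (simp add: eq)
  qed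
  have step: "?P c (Suc k)" if P: "?P c k" and c: "c < N" and k: "k < N" for c k
  proof -
    let ?a = "(Suc c, Suc k)" and ?b = "(Suc c, 0::nat)" and ?c = "(0::nat, Suc k)"
    let ?S = "stair_index N c (Suc k) - {?b, ?c}"
    let ?U = "\<lambda>\<omega>. ?X c k ?a \<omega> + max 0 (?X c k ?b \<omega> - ?X c k ?c \<omega>)"
    let ?V = "\<lambda>\<omega>. ?X c k ?a \<omega> + max 0 (?X c k ?c \<omega> - ?X c k ?b \<omega>)"
    note idx = stair_index_Suc[OF c k]
    have a: "?a \<notin> ?S" by (auto simp: stair_index_def)
    have ind: "indep_vars (\<lambda>_. borel) (?X c k) (insert ?a (insert ?b (insert ?c ?S)))"
      using P idx(1) by simp
    have laws: "distr M borel (?X c k z) = expM (stair_rate \<rho> z)"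
      if "z \<in> insert ?a (insert ?b (insert ?c ?S))" for z
      using P that idx(1) by auto
    have l: "distr M borel (?X c k ?a) = expM 1" "distr M borel (?X c k ?b) = expM \<rho>"
       "distr M borel (?X c k ?c) = expM (1 - \<rho>)"
      using laws[of ?a] laws[of ?b] laws[of ?c] by (simp_all add: stair_rate_def)
    have eq: "?X c (Suc k) z = ((?X c k)(?b := ?U, ?c := ?V)) z" if "z \<in> stair_index N c (Suc k)" for z
      using that by (auto simp: fun_eq_iff stair_Suc)
    have "indep_vars (\<lambda>_. borel) ((?X c k)(?b := ?U, ?c := ?V)) (insert ?b (insert ?c ?S))"
      by (rule indep_vars_resample[OF _ ind _ _ _ _ _ _ \<rho> l]) (use a finite_stair_index in auto)
    then have 1: "indep_vars (\<lambda>_. borel) (?X c (Suc k)) (stair_index N c (Suc k))"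
      by (rule indep_vars_cong[THEN iffD1, rotated 3]) (use eq idx(2) in auto)
    have "distr M borel ?U = expM \<rho>" "distr M borel ?V = expM (1 - \<rho>)"
      by (rule distr_resample_pair(2,3)[OF ind _ _ _ _ \<rho> l]; auto)+
    then have "distr M borel (((?X c k)(?b := ?U, ?c := ?V)) z) = expM (stair_rate \<rho> z)"
      if "z \<in> insert ?b (insert ?c ?S)" for z
      using laws[of z] that by (auto simp: stair_rate_def)
    then have "distr M borel (?X c (Suc k) z) = expM (stair_rate \<rho> z)" if "z \<in> stair_index N c (Suc k)" for z
      using eq[OF that] that idx(2) by auto
    with 1 show ?thesis by blast
  qed
  have column: "?P c k" if "?P c 0" "c < N" "k \<le> N" for c k
    using that(3) by (induction k) (use that step in auto)
  have next_column: "?P (Suc c) 0" if "?P c N" for c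
  proof -
    have "indep_vars (\<lambda>_. borel) (?X (Suc c) 0) (stair_index N (Suc c) 0)"
      by (rule indep_vars_cong[THEN iffD1, OF _ _ _ conjunct1[OF that]])
        (auto simp: stair_index_next_column stair_next_column)
    moreover have "distr M borel (?X (Suc c) 0 z) = expM (stair_rate \<rho> z)" if "z \<in> stair_index N (Suc c) 0" for z
      using \<open>?P c N\<close> that by (auto simp: stair_index_next_column stair_next_column)
    ultimately show ?thesis by blast
  qed
  have first: "?P c 0" if "c < N" for c
    using that
  proof (induction c)
    case (Suc c)
    then show ?case using column[of c N] next_column[of c] by simp
  qed (rule start)
  show ?thesis by (rule column[OF first[OF \<open>c < N\<close>]]) fact+
qed

lemma (in prob_space) indep_vars_reindex:
  assumes inj: "inj_on g J" and ind: "indep_vars M' X (g ` J)"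
  shows "indep_vars (\<lambda>i. M' (g i)) (\<lambda>i. X (g i)) J"
  unfolding indep_vars_def2
proof (intro conjI ballI indep_setsI)
  let ?F = "\<lambda>i. {X i -` A \<inter> space M |A. A \<in> sets (M' i)}"
  have F: "indep_sets ?F (g ` J)" using ind by (simp add: indep_vars_def2)
  show "X (g i) \<in> measurable M (M' (g i))" if "i \<in> J" for i
    using ind that by (auto simp: indep_vars_def2)
  show "?F (g i) \<subseteq> events" if "i \<in> J" for i
    using ind that by (auto simp: indep_vars_def2)
  fix A K assume K: "K \<noteq> {}" "K \<subseteq> J" "finite K" and A: "\<forall>j\<in>K. A j \<in> ?F (g j)"
  have injK: "inj_on g K" using inj K(2) by (rule inj_on_subset)
  let ?B = "\<lambda>z. A (the_inv_into K g z)"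
  have B: "?B (g j) = A j" if "j \<in> K" for j using that injK by (simp add: the_inv_into_f_f)
  have "prob (\<Inter>z\<in>g ` K. ?B z) = (\<Prod>z\<in>g ` K. prob (?B z))"
    by (rule indep_setsD[OF F]) (use K A B in auto)
  then show "prob (\<Inter>j\<in>K. A j) = (\<Prod>j\<in>K. prob (A j))"
    using injK B by (simp add: prod.reindex)
qed

text \<open>All five facts are read off from suitable staircases: rows and columns of increments are
  subfamilies of an independent family.\<close>

lemma (in prob_space) burke:
  fixes v :: "nat \<times> nat \<Rightarrow> 'a \<Rightarrow> real"
  assumes ind: "indep_vars (\<lambda>_. borel) v ({..N} \<times> {..N})"
    and law: "\<And>z. z \<in> {..N} \<times> {..N} \<Longrightarrow> distr M borel (v z) = expM 1"
    and \<rho>: "0 < \<rho>" "\<rho> < 1" and N: "0 < N"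
  shows hinc_indep: "indep_vars (\<lambda>_. borel) (\<lambda>i \<omega>. hinc (\<lambda>z. v z \<omega>) \<rho> i N) {..<N}"
    and hinc_law: "i < N \<Longrightarrow> distr M borel (\<lambda>\<omega>. hinc (\<lambda>z. v z \<omega>) \<rho> i N) = expM \<rho>"
    and vinc_indep: "c \<le> N \<Longrightarrow> indep_vars (\<lambda>_. borel) (\<lambda>j \<omega>. vinc (\<lambda>z. v z \<omega>) \<rho> c j) {..<N}"
    and vinc_law: "c \<le> N \<Longrightarrow> j < N \<Longrightarrow> distr M borel (\<lambda>\<omega>. vinc (\<lambda>z. v z \<omega>) \<rho> c j) = expM (1 - \<rho>)"
    and corner_indep: "N = Suc n \<Longrightarrow> indep_var borel (\<lambda>\<omega>. hinc (\<lambda>z. v z \<omega>) \<rho> n N) borel (\<lambda>\<omega>. vinc (\<lambda>z. v z \<omega>) \<rho> N n)"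
proof -
  let ?X = "\<lambda>c k z \<omega>. stair (\<lambda>z. v z \<omega>) \<rho> N c k z"
  note B = burke_staircase[OF ind law \<rho>]
  have H: "(Suc i, 0) \<in> stair_index N c k" "(0, Suc i) \<in> stair_index N c k" if "i < N" for i c k
    using that by (auto simp: stair_index_def)
  obtain p where p: "N = Suc p" using N gr0_conv_Suc by blast
  then have Nl: "p < N" by simp
  have Xh: "?X p N (Suc i, 0) = (\<lambda>\<omega>. hinc (\<lambda>z. v z \<omega>) \<rho> i N)" if "i < N" for i
    using that p by (auto simp: stair_def fun_eq_iff)
  \<comment> \<open>Column \<open>c < N\<close> is the boundary when nothing of it is filled. Column
    \<open>N\<close> has no staircase of its own, since \<open>burke_staircase\<close> needs
    \<open>c < N\<close>, and is reached by filling the last column completely.\<close>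
  have Xv: "\<exists>c' k'. c' < N \<and> k' \<le> N \<and> (\<forall>j<N. ?X c' k' (0, Suc j) = (\<lambda>\<omega>. vinc (\<lambda>z. v z \<omega>) \<rho> c j))" if "c \<le> N" for c
  proof (cases "c = N")
    case True
    then show ?thesis using p by (intro exI[of _ p] exI[of _ N]) (auto simp: stair_def)
  next
    case False
    then show ?thesis using that by (intro exI[of _ c] exI[of _ 0]) (auto simp: stair_def)
  qed
  have reindex: "indep_vars (\<lambda>_. borel) (\<lambda>i. ?X c k (g i)) {..<N}"
    if "inj_on g {..<N}" "g ` {..<N} \<subseteq> stair_index N c k" "c < N" "k \<le> N" for g :: "nat \<Rightarrow> nat \<times> nat" and c k
    using indep_vars_reindex[OF that(1) indep_vars_subset[OF conjunct1[OF B[OF _ that(3,4)]] that(2)]] by (simp add: comp_def)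
  show "indep_vars (\<lambda>_. borel) (\<lambda>i \<omega>. hinc (\<lambda>z. v z \<omega>) \<rho> i N) {..<N}"
    using reindex[of "\<lambda>i. (Suc i, 0)" p N] Nl H
    by (subst indep_vars_cong[OF refl _ refl, of _ _ "\<lambda>i. ?X p N (Suc i, 0)"]) (auto simp: Xh inj_on_def image_subset_iff)
  show "distr M borel (\<lambda>\<omega>. hinc (\<lambda>z. v z \<omega>) \<rho> i N) = expM \<rho>" if "i < N"
    using B[of p N] Nl H(1)[OF that, of p N] Xh[OF that] by (force simp: stair_rate_def)
  show "indep_vars (\<lambda>_. borel) (\<lambda>j \<omega>. vinc (\<lambda>z. v z \<omega>) \<rho> c j) {..<N}" if c: "c \<le> N"
  proof -
    from Xv[OF c] obtain c' k' where *: "c' < N" "k' \<le> N"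
      "\<And>j. j < N \<Longrightarrow> ?X c' k' (0, Suc j) = (\<lambda>\<omega>. vinc (\<lambda>z. v z \<omega>) \<rho> c j)" by blast
    then show ?thesis
      using reindex[of "\<lambda>i. (0, Suc i)" c' k'] H
      by (subst indep_vars_cong[OF refl _ refl, of _ _ "\<lambda>i. ?X c' k' (0, Suc i)"]) (auto simp: inj_on_def image_subset_iff)
  qed
  show "distr M borel (\<lambda>\<omega>. vinc (\<lambda>z. v z \<omega>) \<rho> c j) = expM (1 - \<rho>)" if c: "c \<le> N" and j: "j < N"
  proof -
    from Xv[OF c] obtain c' k' where *: "c' < N" "k' \<le> N"
      "\<And>j. j < N \<Longrightarrow> ?X c' k' (0, Suc j) = (\<lambda>\<omega>. vinc (\<lambda>z. v z \<omega>) \<rho> c j)" by blast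
    have "distr M borel (?X c' k' (0, Suc j)) = expM (stair_rate \<rho> (0, Suc j))"
      using B[of c' k'] * H(2)[OF j] by blast
    then show ?thesis using *(3)[OF j] by (simp add: stair_rate_def)
  qed
  show "indep_var borel (\<lambda>\<omega>. hinc (\<lambda>z. v z \<omega>) \<rho> n N) borel (\<lambda>\<omega>. vinc (\<lambda>z. v z \<omega>) \<rho> N n)" if n: "N = Suc n"
  proof -
    have "indep_vars (\<lambda>_. borel) (?X n N) (stair_index N n N)"
      using B[of n N] n by simp
    from indep_var_of_indep_vars[OF this, of "(Suc n, 0)" "(0, Suc n)"] H n
    show ?thesis by (simp add: stair_def)
  qed
qed

section \<open>Geodesics and the competition interface\<close>

lemma up_right_path_single: "up_right_path z z [z]"
  by (simp add: up_right_path_def)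

lemma up_right_path_snoc:
  assumes q: "up_right_path z y q" and e: "z' - y \<in> {(1, 0), (0, 1)}"
  shows "up_right_path z z' (q @ [z'])"
  unfolding up_right_path_def
proof (intro conjI allI impI)
  fix k assume k: "Suc k < length (q @ [z'])"
  show "(q @ [z']) ! Suc k - (q @ [z']) ! k \<in> {(1, 0), (0, 1)}"
  proof (cases "Suc k < length q")
    case True
    then show ?thesis using q by (simp add: up_right_path_def nth_append)
  next
    case False
    with k have "Suc k = length q" by simp
    moreover from this have "q ! k = y"
      using q by (auto simp: up_right_path_def last_conv_nth) (metis diff_Suc_1')
    ultimately show ?thesis using e by (simp add: nth_append)
  qed
qed (use q in \<open>auto simp: up_right_path_def hd_append\<close>)

lemma up_right_path_induct [consumes 1, case_names single snoc]:
  assumes "up_right_path z z' p"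
    and single: "P z [z]"
    and snoc: "\<And>y z' q. up_right_path z y q \<Longrightarrow> z' - y \<in> {(1, 0), (0, 1)} \<Longrightarrow> P y q \<Longrightarrow> P z' (q @ [z'])"
  shows "P z' p"
  using assms(1)
proof (induction p arbitrary: z' rule: rev_induct)
  case Nil
  then show ?case by (simp add: up_right_path_def)
next
  case (snoc x q)
  have x: "x = z'" using snoc.prems by (simp add: up_right_path_def)
  show ?case
  proof (cases "q = []")
    case True
    then show ?thesis using snoc.prems single by (auto simp: up_right_path_def)
  next
    case False
    have s: "(q @ [x]) ! Suc k - (q @ [x]) ! k \<in> {(1, 0), (0, 1)}" if "Suc k < length (q @ [x])" for k
      using snoc.prems that unfolding up_right_path_def by blast
    have "q ! Suc k - q ! k \<in> {(1, 0), (0, 1)}" if "Suc k < length q" for k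
      using s[of k] that by (simp add: nth_append)
    moreover have "hd q = z" using snoc.prems False by (simp add: up_right_path_def)
    ultimately have q: "up_right_path z (last q) q" using False by (simp add: up_right_path_def)
    have "z' - last q \<in> {(1, 0), (0, 1)}"
      using s[of "length q - 1"] False x by (simp add: nth_append last_conv_nth)
    then show ?thesis using snoc.IH[OF q] q assms(3) x by blast
  qed
qed

lemma up_right_path_bounds:
  assumes "up_right_path z z' p"
  shows "set p \<subseteq> {fst z..fst z'} \<times> {snd z..snd z'} \<and> z' \<in> set p \<and>
    int (length p) = fst z' - fst z + (snd z' - snd z) + 1"
  using assms
proof (induction rule: up_right_path_induct)
  case single
  then show ?case by (cases z) auto
next
  case (snoc y z' q)
  from snoc(2) have "z' = y + (1, 0) \<or> z' = y + (0, 1)" by (auto simp: algebra_simps)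
  then have le: "fst y \<le> fst z'" "snd y \<le> snd z'" and sum: "fst z' + snd z' = fst y + snd y + 1" by auto
  have y: "fst z \<le> fst y" "snd z \<le> snd y" using snoc(3) by auto
  have "{fst z..fst y} \<times> {snd z..snd y} \<subseteq> {fst z..fst z'} \<times> {snd z..snd z'}"
    using le by (intro Sigma_mono) auto
  then have "set q \<subseteq> {fst z..fst z'} \<times> {snd z..snd z'}" using snoc(3) by blast
  then show ?case using snoc(3) le y sum by (auto simp: mem_Times_iff)
qed

lemma finite_up_right_paths: "finite {p. up_right_path z z' p}"
proof (rule finite_subset)
  show "{p. up_right_path z z' p} \<subseteq> {p. set p \<subseteq> {fst z..fst z'} \<times> {snd z..snd z'} \<and>
      length p \<le> nat (fst z' - fst z + (snd z' - snd z) + 1)}"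
    using up_right_path_bounds by fastforce
  show "finite \<dots>" by (rule finite_lists_length_le) simp
qed

lemma up_right_path_exists: "\<exists>p. up_right_path z (z + (int a, int b)) p"
proof (induction b)
  case 0
  show ?case
  proof (induction a)
    case 0
    show ?case using up_right_path_single[of z] by (auto simp flip: zero_prod_def)
  next
    case (Suc a)
    then obtain p where "up_right_path z (z + (int a, int 0)) p" by blast
    from up_right_path_snoc[OF this, of "z + (int (Suc a), int 0)"] show ?case by force
  qed
next
  case (Suc b)
  then obtain p where "up_right_path z (z + (int a, int b)) p" by blast
  from up_right_path_snoc[OF this, of "z + (int a, int (Suc b))"] show ?case by force
qed

lemma lpp_ge: "up_right_path z z' p \<Longrightarrow> sum_list (map w p) \<le> lpp w z z'"
  unfolding lpp_def by (rule Max_ge) (auto simp: finite_up_right_paths setcompr_eq_image)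

lemma lpp_attained:
  assumes "fst z \<le> fst z'" "snd z \<le> snd z'"
  shows "\<exists>p. up_right_path z z' p \<and> lpp w z z' = sum_list (map w p)"
proof -
  have "\<exists>p. up_right_path z z' p"
    using up_right_path_exists[of z "nat (fst z' - fst z)" "nat (snd z' - snd z)"] assms
    by (cases z; cases z') simp
  then have "lpp w z z' \<in> {sum_list (map w p) | p. up_right_path z z' p}"
    unfolding lpp_def by (intro Max_in) (auto simp: finite_up_right_paths setcompr_eq_image)
  then show ?thesis by blast
qed

lemma G_ge:
  assumes "up_right_path (1, 1) z p"
  shows "sum_list (map w p) \<le> G w z"
  using lpp_ge[OF assms] up_right_path_bounds[OF assms] by (cases z) (force simp: G_def)

lemma G_attained:
  assumes "1 \<le> fst z" "1 \<le> snd z"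
  shows "\<exists>p. up_right_path (1, 1) z p \<and> G w z = sum_list (map w p)"
  using lpp_attained[of "(1, 1)" z w] assms by (simp add: G_def)

lemma G_step:
  assumes "1 \<le> fst z" "1 \<le> snd z" "e \<in> {(1, 0), (0, 1)}"
  shows "G w z + w (z + e) \<le> G w (z + e)"
proof -
  obtain p where "up_right_path (1, 1) z p" "G w z = sum_list (map w p)"
    using G_attained assms by blast
  then show ?thesis using G_ge[OF up_right_path_snoc, of z p "z + e" w] assms by simp
qed

lemma comp_interface_bounds:
  "1 \<le> fst (comp_interface w n) \<and> 1 \<le> snd (comp_interface w n) \<and>
   fst (comp_interface w n) + snd (comp_interface w n) = int n + 2"
  by (induction n) (auto simp: Let_def)

text \<open>On the box \<open>[1, N]\<^sup>2\<close> the function \<open>B\<close> plays the role of a Busemann function: \<open>B z - B z'\<close> bounds the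
  passage time from \<open>z\<close> to \<open>z'\<close> (without the weight at \<open>z'\<close>), with equality along greedy paths.\<close>

definition busemann_on :: "(int \<times> int \<Rightarrow> real) \<Rightarrow> nat \<Rightarrow> (int \<times> int \<Rightarrow> real) \<Rightarrow> bool" where
  "busemann_on w N B \<longleftrightarrow> (\<forall>z. fst z \<in> {1..int N} \<and> snd z \<in> {1..int N} \<longrightarrow>
     B z = w z + max (B (z + (1, 0))) (B (z + (0, 1))))"

lemma busemann_onD:
  assumes "busemann_on w N B" "fst z \<in> {1..int N}" "snd z \<in> {1..int N}"
  shows "B z = w z + max (B (z + (1, 0))) (B (z + (0, 1)))"
  using assms unfolding busemann_on_def by blast

text \<open>Telescoping: a step from \<open>y\<close> to \<open>z'\<close> inside the box satisfies
  \<open>w y + B z' \<le> B y\<close>, whichever entry of the maximum \<open>z'\<close> gives. The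
  weight at the endpoint is added separately.\<close>

lemma G_le_busemann:
  assumes B: "busemann_on w N B" and z: "fst z \<in> {1..int N}" "snd z \<in> {1..int N}"
  shows "G w z \<le> B (1, 1) - B z + w z"
proof -
  have *: "fst z \<le> int N \<and> snd z \<le> int N \<longrightarrow> sum_list (map w p) \<le> B (1, 1) - B z + w z"
    if "up_right_path (1, 1) z p" for p z
    using that
  proof (induction rule: up_right_path_induct)
    case single
    then show ?case by simp
  next
    case (snoc y z' q)
    from snoc(2) have z': "z' = y + (1, 0) \<or> z' = y + (0, 1)" by (auto simp: algebra_simps)
    have "1 \<le> fst y" "1 \<le> snd y" using up_right_path_bounds[OF snoc(1)] by force+
    then have "B y = w y + max (B (y + (1, 0))) (B (y + (0, 1)))" if "fst y \<le> int N" "snd y \<le> int N"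
      using that by (intro busemann_onD[OF B]) auto
    then show ?case using z' snoc(3) by auto
  qed
  obtain p where "up_right_path (1, 1) z p" "G w z = sum_list (map w p)"
    using G_attained z by force
  then show ?thesis using *[of z p] z by simp
qed

fun greedy_path :: "(int \<times> int \<Rightarrow> real) \<Rightarrow> nat \<Rightarrow> int \<times> int" where
  "greedy_path B 0 = (1, 1)"
| "greedy_path B (Suc n) = (let a = greedy_path B n + (1, 0); b = greedy_path B n + (0, 1)
     in if B b \<le> B a then a else b)"

lemma greedy_path_bounds:
  "1 \<le> fst (greedy_path B n) \<and> 1 \<le> snd (greedy_path B n) \<and>
   fst (greedy_path B n) + snd (greedy_path B n) = int n + 2"
  by (induction n) (auto simp: Let_def)

text \<open>A greedy step picks the larger entry of the maximum, so the telescoping inequality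
  becomes an equality and the greedy path is a geodesic.\<close>

lemma G_greedy_path:
  assumes B: "busemann_on w N B" and "n < N"
  shows "G w (greedy_path B n) = B (1, 1) - B (greedy_path B n) + w (greedy_path B n)"
  using assms(2)
proof (induction n)
  case 0
  have "w (1, 1) \<le> G w (1, 1)" using G_ge[OF up_right_path_single, of w] by simp
  then show ?case using G_le_busemann[OF B, of "(1, 1)"] 0 by simp
next
  case (Suc n)
  let ?p = "greedy_path B n" and ?p' = "greedy_path B (Suc n)"
  have bp: "1 \<le> fst ?p" "1 \<le> snd ?p" "fst ?p + snd ?p = int n + 2"
    using greedy_path_bounds[of B n] by auto
  have bp': "1 \<le> fst ?p'" "1 \<le> snd ?p'" "fst ?p' + snd ?p' = int n + 3"
    using greedy_path_bounds[of B "Suc n"] by linarith+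
  have e: "?p' = ?p + (1, 0) \<or> ?p' = ?p + (0, 1)" by (simp add: Let_def)
  have "B ?p = w ?p + max (B (?p + (1, 0))) (B (?p + (0, 1)))"
    by (rule busemann_onD[OF B]) (use bp Suc.prems in auto)
  then have "B ?p = w ?p + B ?p'" by (auto simp: Let_def max_def)
  moreover have "G w ?p + w ?p' \<le> G w ?p'"
    using e G_step[OF bp(1,2), of _ w] by fastforce
  moreover have "G w ?p = B (1, 1) - B ?p + w ?p" using Suc by simp
  moreover have "G w ?p' \<le> B (1, 1) - B ?p' + w ?p'"
    by (rule G_le_busemann[OF B]) (use bp' Suc.prems in auto)
  ultimately show ?case by linarith
qed

text \<open>Time \<open>Suc n\<close> of the greedy path lies on the antidiagonal of the two cells
  compared by the interface at time \<open>n\<close>; the invariant says that the greedy path is at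
  the right one of them or beyond. A violation needs the interface to move right while the greedy
  path goes up from that cell \<open>c + (1, 0)\<close> to \<open>c + (1, 1)\<close>. Being a
  geodesic, it then shows that \<open>c + (1, 0)\<close> has the larger passage time of the two
  compared cells, against the choice of the interface.\<close>

lemma greedy_path_right_of_interface:
  assumes B: "busemann_on w N B" and start: "B (1, 2) \<le> B (2, 1)"
    and ties: "\<And>c. 1 \<le> fst c \<Longrightarrow> 1 \<le> snd c \<Longrightarrow> G w (c + (1, 0)) \<noteq> G w (c + (0, 1))"
    and "Suc n < N"
  shows "fst (comp_interface w n) + 1 \<le> fst (greedy_path B (Suc n))"
  using assms(4)
proof (induction n)
  case 0
  then show ?case using start by simp
next
  case (Suc n)
  let ?c = "comp_interface w n"
  have IH: "fst ?c + 1 \<le> fst (greedy_path B (Suc n))" using Suc by simp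
  have c: "1 \<le> fst ?c" "1 \<le> snd ?c" "fst ?c + snd ?c = int n + 2"
    using comp_interface_bounds[of w n] by auto
  show ?case
  proof (rule ccontr)
    \<comment> \<open>Each path gains at most one unit to the right per step, so a violation fixes
      both moves and the exact position of the greedy path.\<close>
    assume neg: "\<not> ?case"
    have p: "fst (greedy_path B (Suc n)) \<le> fst (greedy_path B (Suc (Suc n)))"
      by (simp add: Let_def)
    have comm: "?c + (0, 1) + (1, 0) = ?c + (1, 0) + (0, 1)" by simp
    have right: "G w (?c + (1, 0)) \<le> G w (?c + (0, 1))" "comp_interface w (Suc n) = ?c + (1, 0)"
      using neg IH p by (auto simp: Let_def split: if_splits)
    have "fst (greedy_path B (Suc n)) = fst ?c + 1" "fst (greedy_path B (Suc (Suc n))) = fst ?c + 1"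
      using neg IH p right(2) by auto
    then have p1: "greedy_path B (Suc n) = ?c + (1, 0)" and p2: "greedy_path B (Suc (Suc n)) = ?c + (1, 0) + (0, 1)"
      using greedy_path_bounds[of B "Suc n"] greedy_path_bounds[of B "Suc (Suc n)"] c
      by (auto simp: prod_eq_iff simp del: greedy_path.simps)
    have g1: "G w (?c + (1, 0)) = B (1, 1) - B (?c + (1, 0)) + w (?c + (1, 0))"
      using G_greedy_path[OF B, of "Suc n"] Suc.prems unfolding p1 by simp
    have g2: "G w (?c + (1, 0) + (0, 1)) = B (1, 1) - B (?c + (1, 0) + (0, 1)) + w (?c + (1, 0) + (0, 1))"
      using G_greedy_path[OF B, of "Suc (Suc n)"] Suc.prems unfolding p2 by simp
    have "B (?c + (1, 0)) = w (?c + (1, 0)) + max (B (?c + (1, 0) + (1, 0))) (B (?c + (1, 0) + (0, 1)))"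
      by (rule busemann_onD[OF B]) (use c Suc.prems in auto)
    moreover have "B (?c + (1, 0) + (1, 0)) \<le> B (?c + (1, 0) + (0, 1))"
      using p2 by (subst (asm) greedy_path.simps(2)) (auto simp: p1 Let_def prod_eq_iff simp del: greedy_path.simps split: if_splits)
    ultimately have "G w (?c + (1, 0) + (0, 1)) \<le> G w (?c + (1, 0)) + w (?c + (1, 0) + (0, 1))"
      using g1 g2 by linarith
    moreover have "G w (?c + (0, 1)) + w (?c + (1, 0) + (0, 1)) \<le> G w (?c + (1, 0) + (0, 1))"
      using G_step[of "?c + (0, 1)" "(1, 0)" w] c unfolding comm by simp
    ultimately show False using right(1) ties[OF c(1,2)] by linarith
  qed
qed

text \<open>The displacement \<open>(a, b)\<close> is that of the greedy path of \<open>B\<close>.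
  The passage time to its position equals an increment of \<open>B\<close> and is at most that of
  any other solution \<open>B'\<close> of the same recursion.\<close>

lemma busemann_crossing:
  assumes B: "busemann_on w N B" and B': "busemann_on w N B'" and start: "B (1, 2) \<le> B (2, 1)"
    and ties: "\<And>c. 1 \<le> fst c \<Longrightarrow> 1 \<le> snd c \<Longrightarrow> G w (c + (1, 0)) \<noteq> G w (c + (0, 1))"
    and n: "Suc n < N"
  shows "\<exists>a b. a + b = Suc n \<and> fst (comp_interface w n) \<le> int a \<and>
    B (1, 1) - B (1 + int a, 1 + int b) \<le> B' (1, 1) - B' (1 + int a, 1 + int b)"
proof -
  let ?p = "greedy_path B (Suc n)"
  have p: "1 \<le> fst ?p" "1 \<le> snd ?p" "fst ?p + snd ?p = int n + 3"
    using greedy_path_bounds[of B "Suc n"] by linarith+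
  have "fst (comp_interface w n) + 1 \<le> fst ?p"
    by (rule greedy_path_right_of_interface[OF B start ties n])
  moreover have "G w ?p = B (1, 1) - B ?p + w ?p"
    by (rule G_greedy_path[OF B n])
  moreover have "G w ?p \<le> B' (1, 1) - B' ?p + w ?p"
    by (rule G_le_busemann[OF B']) (use p n in auto)
  moreover have "?p = (1 + int (nat (fst ?p - 1)), 1 + int (nat (snd ?p - 1)))"
    using p by (simp add: prod_eq_iff)
  ultimately show ?thesis using p
    by (intro exI[of _ "nat (fst ?p - 1)"] exI[of _ "nat (snd ?p - 1)"]) (auto simp del: greedy_path.simps)
qed

section \<open>Reflection in the diagonal\<close>

lemma up_right_path_swap:
  assumes "up_right_path z z' p"
  shows "up_right_path (prod.swap z) (prod.swap z') (map prod.swap p)"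
  using assms
proof (induction rule: up_right_path_induct)
  case (snoc y z' q)
  have "prod.swap z' - prod.swap y \<in> {(1, 0), (0, 1)}" using snoc(2) by (cases z'; cases y) auto
  from up_right_path_snoc[OF snoc(3) this] show ?case by simp
qed (simp add: up_right_path_single)

lemma G_swap_le:
  assumes "1 \<le> fst z" "1 \<le> snd z"
  shows "G w z \<le> G (w \<circ> prod.swap) (prod.swap z)"
proof -
  obtain p where p: "up_right_path (1, 1) z p" "G w z = sum_list (map w p)"
    using G_attained assms by blast
  have "up_right_path (1, 1) (prod.swap z) (map prod.swap p)"
    using up_right_path_swap[OF p(1)] by simp
  from G_ge[OF this, of "w \<circ> prod.swap"] p(2) show ?thesis
    by (simp add: comp_def)
qed

lemma G_swap:
  assumes "1 \<le> fst z" "1 \<le> snd z"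
  shows "G (w \<circ> prod.swap) (prod.swap z) = G w z"
  using G_swap_le[OF assms, of w] G_swap_le[of "prod.swap z" "w \<circ> prod.swap"] assms
  by (simp add: comp_def)

text \<open>Ties are excluded because the interface breaks them towards \<open>(1, 0)\<close>, a
  rule that the reflection does not preserve.\<close>

lemma comp_interface_swap:
  assumes ties: "\<And>c. 1 \<le> fst c \<Longrightarrow> 1 \<le> snd c \<Longrightarrow> G w (c + (1, 0)) \<noteq> G w (c + (0, 1))"
  shows "comp_interface (w \<circ> prod.swap) n = prod.swap (comp_interface w n)"
proof (induction n)
  case (Suc n)
  let ?c = "comp_interface w n"
  have c: "1 \<le> fst ?c" "1 \<le> snd ?c" using comp_interface_bounds[of w n] by auto
  have e: "prod.swap ?c + (1, 0) = prod.swap (?c + (0, 1))" "prod.swap ?c + (0, 1) = prod.swap (?c + (1, 0))"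
    by (cases ?c; simp)+
  have "G (w \<circ> prod.swap) (prod.swap (?c + (0, 1))) = G w (?c + (0, 1))"
    "G (w \<circ> prod.swap) (prod.swap (?c + (1, 0))) = G w (?c + (1, 0))"
    by (rule G_swap; use c in simp)+
  then show ?case using ties[OF c] by (simp only: comp_interface.simps Suc e Let_def) auto
qed simp

text \<open>A path ending no later than the antidiagonal of \<open>a\<close> can visit
  \<open>a\<close> only as its last point. So the weight at \<open>a\<close> enters \<open>G\<close>
  at \<open>a\<close> additively and nowhere else in this range.\<close>

lemma G_upd:
  assumes z: "1 \<le> fst z" "1 \<le> snd z" and le: "fst z + snd z \<le> fst a + snd a"
  shows "G w z = (if z = a then w a else 0) + G (w(a := 0)) z"
proof -
  have *: "fst z + snd z \<le> fst a + snd a \<longrightarrow>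
      sum_list (map w p) = (if z = a then w a else 0) + sum_list (map (w(a := 0)) p)"
    if "up_right_path (1, 1) z p" for p z
    using that
  proof (induction rule: up_right_path_induct)
    case (snoc y z' q)
    from snoc(2) have "z' = y + (1, 0) \<or> z' = y + (0, 1)" by (auto simp: algebra_simps)
    then have "fst z' + snd z' = fst y + snd y + 1" by auto
    then show ?case using snoc(3) by auto
  qed simp
  obtain p where p: "up_right_path (1, 1) z p" "G w z = sum_list (map w p)"
    using G_attained z by blast
  obtain q where q: "up_right_path (1, 1) z q" "G (w(a := 0)) z = sum_list (map (w(a := 0)) q)"
    using G_attained z by blast
  show ?thesis
    using G_ge[OF p(1), of "w(a := 0)"] G_ge[OF q(1), of w] p(2) q(2) *[OF p(1)] *[OF q(1)] le by auto
qed

lemma G_cong: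
  assumes "1 \<le> fst z" "1 \<le> snd z" and "\<And>y. y \<in> {1..fst z} \<times> {1..snd z} \<Longrightarrow> w y = w' y"
  shows "G w z = G w' z"
proof -
  have "sum_list (map w p) = sum_list (map w' p)" if "up_right_path (1, 1) z p" for p
    using up_right_path_bounds[OF that] assms(3) by (intro arg_cong[where f=sum_list] map_cong) auto
  then have "{sum_list (map w p) | p. up_right_path (1, 1) z p} = {sum_list (map w' p) | p. up_right_path (1, 1) z p}"
    by force
  then show ?thesis by (simp add: G_def lpp_def)
qed

lemma G_measurable:
  assumes "\<And>z. w z \<in> borel_measurable M"
  shows "(\<lambda>\<omega>. G (\<lambda>z. w z \<omega>) z) \<in> borel_measurable M"
proof (cases "1 \<le> fst z \<and> 1 \<le> snd z")
  case True
  let ?P = "{p. up_right_path (1, 1) z p}"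
  have "G (\<lambda>z. w z \<omega>) z = Max ((\<lambda>p. sum_list (map (\<lambda>z. w z \<omega>) p)) ` ?P)" for \<omega>
    using True by (simp add: G_def lpp_def setcompr_eq_image)
  moreover have "(\<lambda>\<omega>. sum_list (map (\<lambda>z. w z \<omega>) p)) \<in> borel_measurable M" for p
    using assms by (induction p) auto
  ultimately show ?thesis
    by (simp add: borel_measurable_Max finite_up_right_paths)
next
  case False
  then have "fst z \<le> 0 \<or> snd z \<le> 0" by linarith
  then show ?thesis by (simp add: G_def)
qed

lemma comp_interface_measurable:
  assumes [measurable]: "\<And>z. w z \<in> borel_measurable M"
  shows "(\<lambda>\<omega>. comp_interface (\<lambda>z. w z \<omega>) n) \<in> measurable M (count_space UNIV)"
proof (induction n)
  case (Suc n)
  note Suc[measurable]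
  have [measurable]: "(\<lambda>\<omega>. G (\<lambda>z. w z \<omega>) (comp_interface (\<lambda>z. w z \<omega>) n + e)) \<in> borel_measurable M" for e
    by (rule measurable_compose_countable[where f="\<lambda>c \<omega>. G (\<lambda>z. w z \<omega>) (c + e)", OF G_measurable Suc]) fact
  show ?case unfolding comp_interface.simps Let_def by measurable
qed simp

section \<open>Comparison of stationary fields\<close>

text \<open>On the positive half-line the density of the difference is \<open>1 - \<rho>\<close>
  times the Exp(\<open>\<rho>\<close>) density.\<close>

lemma (in prob_space) exp_indep_less_prob:
  assumes ind: "indep_var borel X borel Y" and \<rho>: "0 < \<rho>" "\<rho> < 1"
    and law: "distr M borel X = expM \<rho>" "distr M borel Y = expM (1 - \<rho>)"
  shows "prob {\<omega> \<in> space M. Y \<omega> < X \<omega>} \<le> 1 - \<rho>"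
proof -
  have [measurable]: "X \<in> borel_measurable M" "Y \<in> borel_measurable M"
    using ind by (auto dest: indep_var_rv1 indep_var_rv2)
  interpret B: prob_space "expM (1 - \<rho>)" by (rule prob_space_expM) (use \<rho> in simp)
  have joint: "distr M (borel \<Otimes>\<^sub>M borel) (\<lambda>\<omega>. (X \<omega>, Y \<omega>)) = expM \<rho> \<Otimes>\<^sub>M expM (1 - \<rho>)"
    using ind law by (simp add: indep_var_distribution_eq)
  let ?h = "\<lambda>d. indicator {0<..} d :: ennreal"
  have "emeasure M {\<omega> \<in> space M. Y \<omega> < X \<omega>} = (\<integral>\<^sup>+\<omega>. ?h (X \<omega> - Y \<omega>) \<partial>M)"
  proof -
    have "emeasure M {\<omega> \<in> space M. Y \<omega> < X \<omega>} = (\<integral>\<^sup>+\<omega>. indicator {\<omega> \<in> space M. Y \<omega> < X \<omega>} \<omega> \<partial>M)" by simp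
    also have "\<dots> = (\<integral>\<^sup>+\<omega>. ?h (X \<omega> - Y \<omega>) \<partial>M)" by (intro nn_integral_cong) (auto simp: indicator_def)
    finally show ?thesis .
  qed
  also have "\<dots> = (\<integral>\<^sup>+p. ?h (fst p - snd p) \<partial>distr M (borel \<Otimes>\<^sub>M borel) (\<lambda>\<omega>. (X \<omega>, Y \<omega>)))"
    by (subst nn_integral_distr) auto
  also have "\<dots> = (\<integral>\<^sup>+x. \<integral>\<^sup>+y. ?h (x - y) \<partial>expM (1 - \<rho>) \<partial>expM \<rho>)"
    unfolding joint by (subst B.nn_integral_fst[symmetric]) auto
  also have "\<dots> = (\<integral>\<^sup>+d. ennreal (diff_density \<rho> d) * (\<integral>\<^sup>+v. ?h d \<partial>expM 1) \<partial>lborel)"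
    by (rule nn_integral_min_diff[where H="\<lambda>_. ?h"]) (use \<rho> in auto)
  also have "\<dots> \<le> (\<integral>\<^sup>+d. ennreal (1 - \<rho>) * ennreal (exponential_density \<rho> d) \<partial>lborel)"
    using \<rho> prob_space.emeasure_space_1[OF prob_space_expM[of 1]]
    by (intro nn_integral_mono)
       (auto simp: diff_density_def exponential_density_def indicator_def mult_ac simp flip: ennreal_mult')
  also have "\<dots> = ennreal (1 - \<rho>) * (\<integral>\<^sup>+x. 1 \<partial>expM \<rho>)"
    by (simp only: nn_integral_cmult nn_integral_expM measurable_const borel_measurable_const mult_1_right)
       (simp add: nn_integral_cmult)
  also have "(\<integral>\<^sup>+x. 1 \<partial>expM \<rho>) = 1"
    using prob_space.emeasure_space_1[OF prob_space_expM[of \<rho>]] \<rho> by simp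
  finally show ?thesis using \<rho> by (simp add: emeasure_eq_measure)
qed

text \<open>For a fixed value of \<open>Y\<close> the diagonal has a single point in its fibre, a
  null set for the absolutely continuous law of \<open>X\<close>.\<close>

lemma (in prob_space) exp_indep_neq:
  assumes ind: "indep_var borel X borel Y" and law: "distr M borel X = expM l" and l: "0 < l"
  shows "AE \<omega> in M. X \<omega> \<noteq> Y \<omega>"
proof -
  have [measurable]: "X \<in> borel_measurable M" "Y \<in> borel_measurable M"
    using ind by (auto dest: indep_var_rv1 indep_var_rv2)
  interpret A: prob_space "expM l" by (rule prob_space_expM) fact
  interpret D: prob_space "distr M borel Y" by (rule prob_space_distr) simp
  interpret AD: pair_prob_space "expM l" "distr M borel Y" ..
  have joint: "distr M (borel \<Otimes>\<^sub>M borel) (\<lambda>\<omega>. (X \<omega>, Y \<omega>)) = expM l \<Otimes>\<^sub>M distr M borel Y"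
    using ind law by (simp add: indep_var_distribution_eq)
  let ?S = "{p :: real \<times> real. fst p = snd p}"
  have S: "?S \<in> sets (borel \<Otimes>\<^sub>M borel)"
  proof -
    have "{p \<in> space (borel \<Otimes>\<^sub>M borel). fst p = (snd p :: real)} \<in> sets (borel \<Otimes>\<^sub>M borel)" by measurable
    then show ?thesis by (simp add: space_pair_measure)
  qed
  have S': "?S \<in> sets (expM l \<Otimes>\<^sub>M distr M borel Y)"
    using S by (subst sets_pair_measure_cong[of _ borel _ borel]) auto
  have "emeasure M {\<omega> \<in> space M. \<not> X \<omega> \<noteq> Y \<omega>} = emeasure (distr M (borel \<Otimes>\<^sub>M borel) (\<lambda>\<omega>. (X \<omega>, Y \<omega>))) ?S"
    using S by (subst emeasure_distr) (auto intro!: arg_cong[where f="emeasure M"])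
  also have "\<dots> = (\<integral>\<^sup>+y. emeasure (expM l) ((\<lambda>x. (x, y)) -` ?S) \<partial>distr M borel Y)"
    unfolding joint by (rule AD.emeasure_pair_measure_alt2[OF S'])
  also have "\<dots> = (\<integral>\<^sup>+y. 0 \<partial>distr M borel Y)"
  proof (intro nn_integral_cong)
    fix y :: real
    have "(\<lambda>x. (x, y)) -` ?S = {y}" by auto
    moreover have "{y} \<in> null_sets lborel" by (simp add: null_sets_def)
    then have "{y} \<in> null_sets (expM l)"
      using absolutely_continuousI_density[of "\<lambda>x. ennreal (exponential_density l x)" lborel]
      unfolding absolutely_continuous_def by auto
    then have "emeasure (expM l) {y} = 0" by (rule null_setsD1)
    ultimately show "emeasure (expM l) ((\<lambda>x. (x, y)) -` ?S) = 0" by simp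
  qed
  finally have "emeasure M {\<omega> \<in> space M. \<not> X \<omega> \<noteq> Y \<omega>} = 0" by simp
  then show ?thesis by (intro AE_I[OF subset_refl]) auto
qed

text \<open>The minimum is the largest \<open>t\<close> allowed by both conditions of
  \<open>exp_sum_chernoff\<close>; the rest is the resulting exponent
  \<open>t * \<delta> / 2\<close>.\<close>

definition chernoff_rate :: "real \<Rightarrow> real \<Rightarrow> real" where
  "chernoff_rate l \<delta> = min (l / 2) (\<delta> * l\<^sup>2 / 4) * \<delta> / 2"

lemma chernoff_rate_pos: "0 < l \<Longrightarrow> 0 < \<delta> \<Longrightarrow> 0 < chernoff_rate l \<delta>"
  by (simp add: chernoff_rate_def)

lemma (in prob_space) exp_sum_deviation:
  fixes X :: "'i \<Rightarrow> 'a \<Rightarrow> real"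
  assumes l: "0 < l" and \<delta>: "0 < \<delta>"
    and K: "finite K" "card K \<le> n" "indep_vars (\<lambda>_. borel) X K" "\<And>i. i \<in> K \<Longrightarrow> distr M borel (X i) = expM l"
  shows exp_sum_deviation_upper:
      "prob {\<omega> \<in> space M. real (card K) / l + \<delta> * real n \<le> (\<Sum>i\<in>K. X i \<omega>)} \<le> exp (- chernoff_rate l \<delta> * real n)"
    and exp_sum_deviation_lower:
      "prob {\<omega> \<in> space M. (\<Sum>i\<in>K. X i \<omega>) \<le> real (card K) / l - \<delta> * real n} \<le> exp (- chernoff_rate l \<delta> * real n)"
proof -
  define t where "t = min (l / 2) (\<delta> * l\<^sup>2 / 4)"
  have t: "0 < t" "\<bar>t\<bar> \<le> l / 2" "2 * \<bar>t\<bar> / l\<^sup>2 \<le> \<delta> / 2" "\<bar>- t\<bar> \<le> l / 2" "2 * \<bar>- t\<bar> / l\<^sup>2 \<le> \<delta> / 2"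
    using l \<delta> by (auto simp: t_def divide_simps min_def)
  have rate: "chernoff_rate l \<delta> = t * \<delta> / 2" by (simp add: chernoff_rate_def t_def)
  have 1: "\<bar>t\<bar> * (\<delta> * real n) \<le> t * ((\<Sum>i\<in>K. X i \<omega>) - real (card K) / l) \<longleftrightarrow>
      real (card K) / l + \<delta> * real n \<le> (\<Sum>i\<in>K. X i \<omega>)" for \<omega>
  proof -
    have "\<bar>t\<bar> * (\<delta> * real n) \<le> t * ((\<Sum>i\<in>K. X i \<omega>) - real (card K) / l) \<longleftrightarrow>
       \<delta> * real n \<le> (\<Sum>i\<in>K. X i \<omega>) - real (card K) / l"
      using t(1) by simp
    then show ?thesis by linarith
  qed
  have 2: "\<bar>- t\<bar> * (\<delta> * real n) \<le> - t * ((\<Sum>i\<in>K. X i \<omega>) - real (card K) / l) \<longleftrightarrow>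
      (\<Sum>i\<in>K. X i \<omega>) \<le> real (card K) / l - \<delta> * real n" for \<omega>
  proof -
    have "\<bar>- t\<bar> * (\<delta> * real n) \<le> - t * ((\<Sum>i\<in>K. X i \<omega>) - real (card K) / l) \<longleftrightarrow>
       t * (\<delta> * real n) \<le> t * (real (card K) / l - (\<Sum>i\<in>K. X i \<omega>))"
      using t(1) by (simp add: algebra_simps)
    also have "\<dots> \<longleftrightarrow> \<delta> * real n \<le> real (card K) / l - (\<Sum>i\<in>K. X i \<omega>)"
      using t(1) by simp
    finally show ?thesis by linarith
  qed
  show "prob {\<omega> \<in> space M. real (card K) / l + \<delta> * real n \<le> (\<Sum>i\<in>K. X i \<omega>)} \<le> exp (- chernoff_rate l \<delta> * real n)"
    using exp_sum_chernoff[OF K l t(2,3)] t(1) unfolding 1 rate by simp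
  show "prob {\<omega> \<in> space M. (\<Sum>i\<in>K. X i \<omega>) \<le> real (card K) / l - \<delta> * real n} \<le> exp (- chernoff_rate l \<delta> * real n)"
    using exp_sum_chernoff[OF K l t(4,5)] t(1) unfolding 2 rate by simp
qed

lemma measure_Un4_le:
  assumes "A \<in> sets M" "B \<in> sets M" "C \<in> sets M" "D \<in> sets M"
    and "measure M A \<le> e" "measure M B \<le> e" "measure M C \<le> e" "measure M D \<le> e"
  shows "measure M (A \<union> B \<union> (C \<union> D)) \<le> 4 * e"
proof -
  have "measure M (A \<union> B \<union> (C \<union> D)) \<le> measure M (A \<union> B) + measure M (C \<union> D)"
    using assms by (intro measure_Un_le) auto
  moreover have "measure M (A \<union> B) \<le> measure M A + measure M B" "measure M (C \<union> D) \<le> measure M C + measure M D"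
    using assms by (auto intro: measure_Un_le)
  ultimately show ?thesis using assms(5-8) by linarith
qed

text \<open>At \<open>b = s * a\<close> the difference of means equals \<open>(\<sigma> -
  \<rho>)\<^sup>2 / (\<sigma>\<^sup>2 * \<rho> * (1 - \<rho>)) * a\<close>, since
  \<open>\<sigma>\<close> is the minimiser there. Lowering \<open>b\<close> only widens the gap,
  because \<open>\<rho> < \<sigma>\<close> makes \<open>1 / (1 - \<rho>)\<close> the smaller
  coefficient. The factor \<open>1 / (1 + s)\<close> turns \<open>a\<close> into
  \<open>a + b\<close>.\<close>

lemma mean_gap:
  fixes \<rho> \<sigma> a b s :: real
  assumes \<rho>: "0 < \<rho>" "\<rho> < \<sigma>" "\<sigma> < 1" and s: "s = ((1 - \<sigma>) / \<sigma>)\<^sup>2" and b: "b \<le> s * a"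
  shows "(\<sigma> - \<rho>)\<^sup>2 / (\<sigma>\<^sup>2 * \<rho> * (1 - \<rho>)) / (1 + s) * (a + b) \<le> (a / \<rho> + b / (1 - \<rho>)) - (a / \<sigma> + b / (1 - \<sigma>))"
proof -
  let ?k = "(\<sigma> - \<rho>)\<^sup>2 / (\<sigma>\<^sup>2 * \<rho> * (1 - \<rho>))"
  have s0: "0 < s" using \<rho> s by simp
  have "?k / (1 + s) * (a + b) \<le> ?k / (1 + s) * ((1 + s) * a)"
  proof (rule mult_left_mono)
    show "a + b \<le> (1 + s) * a" using b by (simp add: algebra_simps)
    show "0 \<le> ?k / (1 + s)" using s0 \<rho> by (intro divide_nonneg_nonneg mult_nonneg_nonneg) auto
  qed
  also have "\<dots> = ?k * a" using s0 by simp
  also have "?k * a = (a / \<rho> + (s * a) / (1 - \<rho>)) - (a / \<sigma> + (s * a) / (1 - \<sigma>))"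
  proof -
    have "?k = (1 / \<rho> + s / (1 - \<rho>)) - (1 / \<sigma> + s / (1 - \<sigma>))"
      unfolding s using \<rho> by (simp add: divide_simps) (simp add: power2_eq_square algebra_simps)
    then have "?k * a = ((1 / \<rho> + s / (1 - \<rho>)) - (1 / \<sigma> + s / (1 - \<sigma>))) * a" by simp
    also have "\<dots> = (a / \<rho> + (s * a) / (1 - \<rho>)) - (a / \<sigma> + (s * a) / (1 - \<sigma>))"
      by (simp add: algebra_simps)
    finally show ?thesis .
  qed
  also have "\<dots> \<le> (a / \<rho> + b / (1 - \<rho>)) - (a / \<sigma> + b / (1 - \<sigma>))"
  proof -
    have "1 / (1 - \<rho>) \<le> 1 / (1 - \<sigma>)" using \<rho> by (simp add: frac_le)
    then have "(s * a - b) * (1 / (1 - \<rho>)) \<le> (s * a - b) * (1 / (1 - \<sigma>))"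
      using b by (intro mult_left_mono) auto
    then show ?thesis by (simp add: algebra_simps diff_divide_distrib)
  qed
  finally show ?thesis .
qed

section \<open>The exponential model and its stationary fields\<close>

locale exp_lpp = prob_space M for M :: "'a measure" +
  fixes w :: "int \<times> int \<Rightarrow> 'a \<Rightarrow> real"
  assumes indep: "indep_vars (\<lambda>_. borel) w UNIV"
    and law: "\<And>z. distr M borel (w z) = expM 1"
begin

lemma w_measurable [measurable]: "w z \<in> borel_measurable M"
  using indep unfolding indep_vars_def by blast

abbreviation W :: "'a \<Rightarrow> int \<times> int \<Rightarrow> real" where
  "W \<omega> \<equiv> \<lambda>z. w z \<omega>"

text \<open>The difference of the two passage times is the weight at \<open>a = c + (1, 0)\<close>
  minus a function of the other weights, so a tie forces a continuous variable to equal an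
  independent one.\<close>

lemma no_ties: "AE \<omega> in M. \<forall>c. 1 \<le> fst c \<longrightarrow> 1 \<le> snd c \<longrightarrow> G (W \<omega>) (c + (1, 0)) \<noteq> G (W \<omega>) (c + (0, 1))"
proof (subst AE_all_countable, intro allI)
  fix c :: "int \<times> int"
  show "AE \<omega> in M. 1 \<le> fst c \<longrightarrow> 1 \<le> snd c \<longrightarrow> G (W \<omega>) (c + (1, 0)) \<noteq> G (W \<omega>) (c + (0, 1))"
  proof (cases "1 \<le> fst c \<and> 1 \<le> snd c")
    case c: True
    define a where "a = c + (1, 0)"
    \<comment> \<open>\<open>K\<close> holds all other weights that matter for the two cells.
      Setting weights outside \<open>K\<close> to zero in \<open>g\<close> makes \<open>Y\<close> a
      measurable function on the product over \<open>K\<close>, to which independence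
      applies.\<close>
    define K where "K = {1..fst c + 1} \<times> {1..snd c + 1} - {a}"
    define g where "g f z = (if z \<in> K then f z else 0)" for f :: "int \<times> int \<Rightarrow> real" and z
    define Y where "Y f = G (g f) (c + (0, 1)) - G (g f) a" for f
    have "indep_var borel ((\<lambda>f. f a) \<circ> (\<lambda>\<omega>. restrict (W \<omega>) {a})) borel (Y \<circ> (\<lambda>\<omega>. restrict (W \<omega>) K))"
    proof (rule indep_var_compose[OF indep_var_restrict[OF indep]])
      have "(\<lambda>f. g f z) \<in> borel_measurable (PiM K (\<lambda>_. borel))" for z
        unfolding g_def by (cases "z \<in> K") auto
      then have "(\<lambda>f. G (\<lambda>z. g f z) z) \<in> borel_measurable (PiM K (\<lambda>_. borel))" for z
        by (rule G_measurable)
      then show "Y \<in> borel_measurable (PiM K (\<lambda>_. borel))" unfolding Y_def by simp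
    qed (auto simp: K_def)
    then have "indep_var borel (w a) borel (\<lambda>\<omega>. Y (restrict (W \<omega>) K))" by (simp add: comp_def)
    from exp_indep_neq[OF this law] have ne: "AE \<omega> in M. w a \<omega> \<noteq> Y (restrict (W \<omega>) K)" by simp
    have eq: "G (W \<omega>) (c + (1, 0)) - G (W \<omega>) (c + (0, 1)) = w a \<omega> - Y (restrict (W \<omega>) K)" for \<omega>
    proof -
      have "G ((W \<omega>)(a := 0)) z = G (g (restrict (W \<omega>) K)) z" if "z = a \<or> z = c + (0, 1)" for z
        using that c by (intro G_cong) (auto simp: g_def K_def a_def)
      moreover have "G (W \<omega>) a = w a \<omega> + G ((W \<omega>)(a := 0)) a"
        using G_upd[of a a "W \<omega>"] c by (simp add: a_def)
      moreover have "c + (0, 1) \<noteq> a" by (simp add: a_def prod_eq_iff)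
      then have "G (W \<omega>) (c + (0, 1)) = G ((W \<omega>)(a := 0)) (c + (0, 1))"
        using G_upd[of "c + (0, 1)" a "W \<omega>"] c by (simp add: a_def)
      ultimately show ?thesis by (simp add: Y_def a_def)
    qed
    show ?thesis
      using ne
    proof eventually_elim
      case (elim \<omega>)
      then show ?case using eq[of \<omega>] by auto
    qed
  qed auto
qed

text \<open>Half-turn sending the corner \<open>(N + 1, N + 1)\<close> to the origin, as
  \<open>stat_lpp\<close> expects.\<close>

definition box_weight :: "nat \<Rightarrow> nat \<times> nat \<Rightarrow> 'a \<Rightarrow> real" where
  "box_weight N z = w (int N + 1 - int (fst z), int N + 1 - int (snd z))"

lemma box_weight_indep: "indep_vars (\<lambda>_. borel) (box_weight N) ({..N} \<times> {..N})"
  unfolding box_weight_def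
  using indep_vars_reindex[of "\<lambda>z. (int N + 1 - int (fst z), int N + 1 - int (snd z))" "{..N} \<times> {..N}" "\<lambda>_. borel" w]
    indep_vars_subset[OF indep]
  by (auto simp: inj_on_def)

lemma box_weight_law: "distr M borel (box_weight N z) = expM 1"
  by (simp add: box_weight_def law)

text \<open>The stationary passage time from \<open>z\<close> to the corner \<open>(N + 1, N + 1)\<close>; the rescaled weights in row and
  column \<open>N + 1\<close>, which are independent of the box, serve as the boundary condition.\<close>

definition stat_field :: "nat \<Rightarrow> real \<Rightarrow> 'a \<Rightarrow> int \<times> int \<Rightarrow> real" where
  "stat_field N \<rho> \<omega> z =
     stat_lpp (\<lambda>z. box_weight N z \<omega>) \<rho> (nat (int N + 1 - fst z)) (nat (int N + 1 - snd z))"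

lemma busemann_stat_field: "busemann_on (W \<omega>) N (stat_field N \<rho> \<omega>)"
  unfolding busemann_on_def
proof (intro allI impI)
  fix z :: "int \<times> int" assume z: "fst z \<in> {1..int N} \<and> snd z \<in> {1..int N}"
  define m n where "m = nat (int N - fst z)" and "n = nat (int N - snd z)"
  have "z = (int N - int m, int N - int n)"
    using z by (simp add: m_def n_def prod_eq_iff)
  moreover have "nat (int N + 1 - (int N - int i)) = Suc i" "nat (int N + 1 - (int N - int i + 1)) = i" for i by auto
  ultimately show "stat_field N \<rho> \<omega> z = w z \<omega> + max (stat_field N \<rho> \<omega> (z + (1, 0))) (stat_field N \<rho> \<omega> (z + (0, 1)))"
    by (simp add: stat_field_def box_weight_def)
qed

lemma stat_field_measurable [measurable]: "(\<lambda>\<omega>. stat_field N \<rho> \<omega> z) \<in> borel_measurable M"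
proof -
  have "(\<lambda>\<omega>. stat_lpp (\<lambda>z. box_weight N z \<omega>) \<rho> m n) \<in> borel_measurable M" for m n
    by (induction "\<lambda>z::nat \<times> nat. 0::real" \<rho> m n rule: stat_lpp.induct) (auto simp: box_weight_def)
  then show ?thesis by (simp add: stat_field_def)
qed

text \<open>The two values differ as the horizontal and the vertical increment leaving
  \<open>(1, 1)\<close> do, and these are independent by \<open>corner_indep\<close>.\<close>

lemma stat_field_corner:
  assumes "0 < \<rho>" "\<rho> < 1" "0 < N"
  shows "prob {\<omega> \<in> space M. stat_field N \<rho> \<omega> (2, 1) < stat_field N \<rho> \<omega> (1, 2)} \<le> 1 - \<rho>"
proof -
  obtain n where N: "N = Suc n" using assms gr0_conv_Suc by blast
  note B = box_weight_indep[of N] box_weight_law assms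
  have "stat_field N \<rho> \<omega> (2, 1) < stat_field N \<rho> \<omega> (1, 2) \<longleftrightarrow>
     vinc (\<lambda>z. box_weight N z \<omega>) \<rho> N n < hinc (\<lambda>z. box_weight N z \<omega>) \<rho> n N" for \<omega>
  proof -
    have "nat (1 + int n) = Suc n" by simp
    then show ?thesis
      using hinc_minus_vinc[of "\<lambda>z. box_weight N z \<omega>" \<rho> n n] by (auto simp add: stat_field_def N)
  qed
  moreover have "prob {\<omega> \<in> space M. vinc (\<lambda>z. box_weight N z \<omega>) \<rho> N n < hinc (\<lambda>z. box_weight N z \<omega>) \<rho> n N} \<le> 1 - \<rho>"
    by (rule exp_indep_less_prob[OF corner_indep[OF B N] assms(1,2) hinc_law[OF B] vinc_law[OF B]]) (auto simp: N)
  ultimately show ?thesis by simp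
qed

text \<open>The increment is summed along row 1 to the right and then up column
  \<open>1 + a\<close>. Counted from the far corner these are row \<open>N\<close> and column
  \<open>N - a\<close>, for which \<open>burke\<close> supplies i.i.d. families.\<close>

lemma stat_field_minus:
  assumes "a \<le> N" "b \<le> N"
  shows "stat_field N \<rho> \<omega> (1, 1) - stat_field N \<rho> \<omega> (1 + int a, 1 + int b) =
    (\<Sum>i = N - a..<N. hinc (\<lambda>z. box_weight N z \<omega>) \<rho> i N) + (\<Sum>j = N - b..<N. vinc (\<lambda>z. box_weight N z \<omega>) \<rho> (N - a) j)"
proof -
  have "nat (int N - int k) = N - k" for k by simp
  then show ?thesis
    using stat_lpp_minus[of "N - a" N "N - b" N "\<lambda>z. box_weight N z \<omega>" \<rho>] by (simp add: stat_field_def)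
qed

text \<open>If none of the four sums of increments deviates, the ordering of the means decides. The
  rate \<open>c\<close> is the worst of four Chernoff rates and is uniform in \<open>N\<close>,
  \<open>a\<close> and \<open>b\<close>.\<close>

lemma stat_field_compare:
  assumes \<rho>: "0 < \<rho>" "\<rho> < \<sigma>" "\<sigma> < 1" and s: "s = ((1 - \<sigma>) / \<sigma>)\<^sup>2"
  obtains c where "0 < c"
    "\<And>N a b. a + b < N \<Longrightarrow> real b \<le> s * real a \<Longrightarrow>
      prob {\<omega> \<in> space M. stat_field N \<rho> \<omega> (1, 1) - stat_field N \<rho> \<omega> (1 + int a, 1 + int b)
        \<le> stat_field N \<sigma> \<omega> (1, 1) - stat_field N \<sigma> \<omega> (1 + int a, 1 + int b)} \<le> 4 * exp (- c * real (a + b))"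
proof -
  \<comment> \<open>One fifth of the gap per step: four deviations of size
    \<open>\<delta> * n\<close> together stay below the gap of
    \<open>5 * \<delta> * n\<close>.\<close>
  define \<delta> where "\<delta> = (\<sigma> - \<rho>)\<^sup>2 / (\<sigma>\<^sup>2 * \<rho> * (1 - \<rho>)) / (1 + s) / 5"
  have "0 \<le> s" using s by simp
  then have \<delta>: "0 < \<delta>" using \<rho> unfolding \<delta>_def by (intro divide_pos_pos mult_pos_pos) auto
  have \<rho>1: "\<rho> < 1" "0 < \<sigma>" "0 < 1 - \<rho>" "0 < 1 - \<sigma>" using \<rho> by auto
  define c where "c = min (min (chernoff_rate \<rho> \<delta>) (chernoff_rate (1 - \<rho>) \<delta>))
      (min (chernoff_rate \<sigma> \<delta>) (chernoff_rate (1 - \<sigma>) \<delta>))"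
  have c: "c \<le> chernoff_rate \<rho> \<delta>" "c \<le> chernoff_rate (1 - \<rho>) \<delta>" "c \<le> chernoff_rate \<sigma> \<delta>" "c \<le> chernoff_rate (1 - \<sigma>) \<delta>"
    by (auto simp: c_def)
  have "0 < c" using chernoff_rate_pos \<rho> \<rho>1 \<delta> by (simp add: c_def)
  show thesis
  proof (rule that[of c])
    fix N a b :: nat assume ab: "a + b < N" and b: "real b \<le> s * real a"
    let ?n = "a + b"
    define H where "H l i \<omega> = hinc (\<lambda>z. box_weight N z \<omega>) l i N" for l i \<omega>
    define V where "V l i \<omega> = vinc (\<lambda>z. box_weight N z \<omega>) l (N - a) i" for l i \<omega>
    let ?A = "{N - a..<N}" and ?B = "{N - b..<N}"
    have sub: "?A \<subseteq> {..<N}" "?B \<subseteq> {..<N}" by auto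
    have N: "0 < N" using ab by simp
    have H: "indep_vars (\<lambda>_. borel) (H l) ?A" "\<And>i. i \<in> ?A \<Longrightarrow> distr M borel (H l i) = expM l"
      if "0 < l" "l < 1" for l
      unfolding H_def
      using indep_vars_subset[OF hinc_indep[OF box_weight_indep box_weight_law that N] sub(1)]
        hinc_law[OF box_weight_indep box_weight_law that N] by auto
    have V: "indep_vars (\<lambda>_. borel) (V l) ?B" "\<And>i. i \<in> ?B \<Longrightarrow> distr M borel (V l i) = expM (1 - l)"
      if "0 < l" "l < 1" for l
      unfolding V_def
      using indep_vars_subset[OF vinc_indep[OF box_weight_indep box_weight_law that N] sub(2)]
        vinc_law[OF box_weight_indep box_weight_law that N] by auto
    have card: "card ?A = a" "card ?B = b" using ab by auto
    have [measurable]: "i \<in> ?A \<Longrightarrow> H l i \<in> borel_measurable M" "i \<in> ?B \<Longrightarrow> V l i \<in> borel_measurable M"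
      if "0 < l" "l < 1" for l i
      using H(1)[OF that] V(1)[OF that] by (auto simp: indep_vars_def)
    have E: "exp (- d * real ?n) \<le> exp (- c * real ?n)" if "c \<le> d" for d
      using that by (simp add: mult_right_mono)
    let ?E1 = "{\<omega> \<in> space M. (\<Sum>i\<in>?A. H \<rho> i \<omega>) \<le> real a / \<rho> - \<delta> * real ?n}"
    let ?E2 = "{\<omega> \<in> space M. (\<Sum>i\<in>?B. V \<rho> i \<omega>) \<le> real b / (1 - \<rho>) - \<delta> * real ?n}"
    let ?E3 = "{\<omega> \<in> space M. real a / \<sigma> + \<delta> * real ?n \<le> (\<Sum>i\<in>?A. H \<sigma> i \<omega>)}"
    let ?E4 = "{\<omega> \<in> space M. real b / (1 - \<sigma>) + \<delta> * real ?n \<le> (\<Sum>i\<in>?B. V \<sigma> i \<omega>)}"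
    have "prob ?E1 \<le> exp (- c * real ?n)"
      using order_trans[OF exp_sum_deviation_lower[OF \<rho>(1) \<delta> _ _ H[OF \<rho>(1) \<rho>1(1)], of ?n] E[OF c(1)]] card by simp
    moreover have "prob ?E2 \<le> exp (- c * real ?n)"
      using order_trans[OF exp_sum_deviation_lower[OF \<rho>1(3) \<delta> _ _ V[OF \<rho>(1) \<rho>1(1)], of ?n] E[OF c(2)]] card by simp
    moreover have "prob ?E3 \<le> exp (- c * real ?n)"
      using order_trans[OF exp_sum_deviation_upper[OF \<rho>1(2) \<delta> _ _ H[OF \<rho>1(2) \<rho>(3)], of ?n] E[OF c(3)]] card by simp
    moreover have "prob ?E4 \<le> exp (- c * real ?n)"
      using order_trans[OF exp_sum_deviation_upper[OF \<rho>1(4) \<delta> _ _ V[OF \<rho>1(2) \<rho>(3)], of ?n] E[OF c(4)]] card by simp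
    moreover have meas: "?E1 \<in> events" "?E2 \<in> events" "?E3 \<in> events" "?E4 \<in> events"
      using \<rho> \<rho>1 by measurable
    ultimately have un: "prob (?E1 \<union> ?E2 \<union> (?E3 \<union> ?E4)) \<le> 4 * exp (- c * real ?n)"
      by (intro measure_Un4_le)
    have gap: "5 * \<delta> * real ?n \<le> (real a / \<rho> + real b / (1 - \<rho>)) - (real a / \<sigma> + real b / (1 - \<sigma>))"
      using mean_gap[OF \<rho> s b] by (simp add: \<delta>_def)
    let ?S = "{\<omega> \<in> space M. stat_field N \<rho> \<omega> (1, 1) - stat_field N \<rho> \<omega> (1 + int a, 1 + int b)
        \<le> stat_field N \<sigma> \<omega> (1, 1) - stat_field N \<sigma> \<omega> (1 + int a, 1 + int b)}"
    have eq: "stat_field N l \<omega> (1, 1) - stat_field N l \<omega> (1 + int a, 1 + int b) =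
       (\<Sum>i\<in>?A. H l i \<omega>) + (\<Sum>i\<in>?B. V l i \<omega>)" for l \<omega>
      using stat_field_minus[of a N b l \<omega>] ab by (simp add: H_def V_def)
    have dn: "0 \<le> \<delta> * real ?n" using \<delta> by simp
    have "?S \<subseteq> ?E1 \<union> ?E2 \<union> (?E3 \<union> ?E4)"
    proof (rule subsetI, rule ccontr)
      fix \<omega> assume S: "\<omega> \<in> ?S" and E: "\<omega> \<notin> ?E1 \<union> ?E2 \<union> (?E3 \<union> ?E4)"
      from S have sp: "\<omega> \<in> space M" by blast
      from E have "\<omega> \<notin> ?E1" "\<omega> \<notin> ?E2" "\<omega> \<notin> ?E3" "\<omega> \<notin> ?E4" by blast+
      then have "real a / \<rho> - \<delta> * real ?n < (\<Sum>i\<in>?A. H \<rho> i \<omega>)" "real b / (1 - \<rho>) - \<delta> * real ?n < (\<Sum>i\<in>?B. V \<rho> i \<omega>)"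
        "(\<Sum>i\<in>?A. H \<sigma> i \<omega>) < real a / \<sigma> + \<delta> * real ?n" "(\<Sum>i\<in>?B. V \<sigma> i \<omega>) < real b / (1 - \<sigma>) + \<delta> * real ?n"
        by (simp_all only: mem_Collect_eq sp simp_thms not_le)
      moreover have "(\<Sum>i\<in>?A. H \<rho> i \<omega>) + (\<Sum>i\<in>?B. V \<rho> i \<omega>) \<le> (\<Sum>i\<in>?A. H \<sigma> i \<omega>) + (\<Sum>i\<in>?B. V \<sigma> i \<omega>)"
        using S unfolding eq mem_Collect_eq by blast
      ultimately show False using gap dn by linarith
    qed
    then have "prob ?S \<le> prob (?E1 \<union> ?E2 \<union> (?E3 \<union> ?E4))"
      by (rule finite_measure_mono[OF _ sets.Un[OF sets.Un[OF meas(1,2)] sets.Un[OF meas(3,4)]]])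
    from order_trans[OF this un] show "prob ?S \<le> 4 * exp (- c * real (a + b))" .
  qed fact
qed

end

section \<open>Direction of the competition interface\<close>

text \<open>For the lower limit \<open>L\<close> and the upper limit \<open>U\<close>, the
  hypotheses give \<open>P (L \<le> \<alpha>) \<le> F \<alpha> \<le> P (U \<le> \<alpha>)\<close>,
  while \<open>L \<le> U\<close> gives the reverse order of the outer terms. So no level
  \<open>\<alpha>\<close> separates \<open>L\<close> from \<open>U\<close> with positive
  probability.\<close>

lemma (in prob_space) converges_if_frequency_bounds:
  fixes A :: "nat \<Rightarrow> 'a \<Rightarrow> real" and F :: "real \<Rightarrow> real"
  assumes A[measurable]: "\<And>n. A n \<in> borel_measurable M" and bnd: "\<And>n \<omega>. A n \<omega> \<in> {0..b}"
    and F: "continuous_on {0..b} F" "F 0 = 0" "F b = 1"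
    and lo: "\<And>\<alpha>. 0 < \<alpha> \<Longrightarrow> \<alpha> < b \<Longrightarrow> prob {\<omega> \<in> space M. \<exists>\<^sub>F n in sequentially. A n \<omega> \<le> \<alpha>} \<le> F \<alpha>"
    and hi: "\<And>\<alpha>. 0 < \<alpha> \<Longrightarrow> \<alpha> < b \<Longrightarrow> prob {\<omega> \<in> space M. \<exists>\<^sub>F n in sequentially. \<alpha> \<le> A n \<omega>} \<le> 1 - F \<alpha>"
  shows "\<exists>\<theta>. \<theta> \<in> borel_measurable M \<and> (\<forall>\<omega>. \<theta> \<omega> \<in> {0..b}) \<and>
    (AE \<omega> in M. (\<lambda>n. A n \<omega>) \<longlonglongrightarrow> \<theta> \<omega>) \<and> (\<forall>\<alpha>\<in>{0..b}. prob {\<omega> \<in> space M. \<theta> \<omega> \<le> \<alpha>} = F \<alpha>)"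
proof -
  define l u where "l \<omega> = liminf (\<lambda>n. ereal (A n \<omega>))" and "u \<omega> = limsup (\<lambda>n. ereal (A n \<omega>))" for \<omega>
  define L U where "L \<omega> = real_of_ereal (l \<omega>)" and "U \<omega> = real_of_ereal (u \<omega>)" for \<omega>
  have lu_bnd: "ereal 0 \<le> l \<omega>" "l \<omega> \<le> u \<omega>" "u \<omega> \<le> ereal b" for \<omega>
    unfolding l_def u_def using bnd
    by (auto intro!: Liminf_bounded Limsup_bounded Liminf_le_Limsup)
  have l: "l \<omega> = ereal (L \<omega>)" and u: "u \<omega> = ereal (U \<omega>)" for \<omega>
    using lu_bnd[of \<omega>] unfolding L_def U_def by (cases "l \<omega>"; cases "u \<omega>"; simp)+
  have LU: "0 \<le> L \<omega>" "L \<omega> \<le> U \<omega>" "U \<omega> \<le> b" for \<omega>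
    using lu_bnd[of \<omega>] by (auto simp: l u)
  have [measurable]: "L \<in> borel_measurable M" "U \<in> borel_measurable M"
    unfolding L_def U_def l_def u_def by measurable
  \<comment> \<open>The bounds on \<open>A\<close> force \<open>0 \<le> b\<close>, and
    \<open>b = 0\<close> would make \<open>F 0\<close> both 0 and 1.\<close>
  have b: "0 < b" using LU[of undefined] F by (cases "b = 0") auto
  have Fr: "((\<lambda>\<beta>. F \<beta>) \<longlongrightarrow> F \<alpha>) (at_right \<alpha>)" if "0 \<le> \<alpha>" "\<alpha> < b" for \<alpha>
    by (rule continuous_on_Icc_at_rightD[OF continuous_on_subset[OF F(1)], of \<alpha> b]) (use that in auto)
  have L_less: "prob {\<omega> \<in> space M. L \<omega> < \<alpha>} \<le> F \<alpha>" if "0 < \<alpha>" "\<alpha> < b" for \<alpha>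
  proof -
    have "\<exists>\<^sub>F n in sequentially. A n \<omega> \<le> \<alpha>" if "L \<omega> < \<alpha>" for \<omega>
    proof (rule ccontr)
      assume "\<not> ?thesis"
      then have "\<forall>\<^sub>F n in sequentially. ereal \<alpha> \<le> ereal (A n \<omega>)"
        by (auto simp: not_frequently elim: eventually_mono)
      then have "ereal \<alpha> \<le> l \<omega>" unfolding l_def by (rule Liminf_bounded)
      then show False using that by (simp add: l)
    qed
    then have "prob {\<omega> \<in> space M. L \<omega> < \<alpha>} \<le> prob {\<omega> \<in> space M. \<exists>\<^sub>F n in sequentially. A n \<omega> \<le> \<alpha>}"
      by (intro finite_measure_mono) (auto simp: frequently_sequentially)
    then show ?thesis using lo[OF that] by linarith
  qed
  have U_le: "F \<alpha> \<le> prob {\<omega> \<in> space M. U \<omega> \<le> \<alpha>}" if "0 < \<alpha>" "\<alpha> < b" for \<alpha>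
  proof -
    have "\<exists>\<^sub>F n in sequentially. \<alpha> \<le> A n \<omega>" if "\<alpha> < U \<omega>" for \<omega>
    proof (rule ccontr)
      assume "\<not> ?thesis"
      then have "\<forall>\<^sub>F n in sequentially. ereal (A n \<omega>) \<le> ereal \<alpha>"
        by (auto simp: not_frequently elim: eventually_mono)
      then have "u \<omega> \<le> ereal \<alpha>" unfolding u_def by (rule Limsup_bounded)
      then show False using that by (simp add: u)
    qed
    then have "prob {\<omega> \<in> space M. \<alpha> < U \<omega>} \<le> prob {\<omega> \<in> space M. \<exists>\<^sub>F n in sequentially. \<alpha> \<le> A n \<omega>}"
      by (intro finite_measure_mono) (auto simp: frequently_sequentially)
    moreover have "prob {\<omega> \<in> space M. \<not> U \<omega> \<le> \<alpha>} = 1 - prob {\<omega> \<in> space M. U \<omega> \<le> \<alpha>}"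
      by (rule prob_neg) simp
    ultimately show ?thesis using hi[OF that] by (simp add: not_le)
  qed
  \<comment> \<open>\<open>L \<omega> \<le> \<alpha>\<close> only makes \<open>A\<close> drop below
    each \<open>\<beta> > \<alpha>\<close> infinitely often; right-continuity of \<open>F\<close>
    closes the difference.\<close>
  have L_le: "prob {\<omega> \<in> space M. L \<omega> \<le> \<alpha>} \<le> F \<alpha>" if \<alpha>: "0 \<le> \<alpha>" "\<alpha> < b" for \<alpha>
  proof (rule tendsto_lowerbound[OF Fr[OF \<alpha>]])
    have "\<forall>\<^sub>F \<beta> in at_right \<alpha>. \<beta> \<in> {\<alpha><..<b}"
      using \<alpha> by (rule_tac eventually_at_right_real) auto
    then show "\<forall>\<^sub>F \<beta> in at_right \<alpha>. prob {\<omega> \<in> space M. L \<omega> \<le> \<alpha>} \<le> F \<beta>"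
    proof eventually_elim
      case (elim \<beta>)
      have "prob {\<omega> \<in> space M. L \<omega> \<le> \<alpha>} \<le> prob {\<omega> \<in> space M. L \<omega> < \<beta>}"
        using elim by (intro finite_measure_mono) auto
      also have "\<dots> \<le> F \<beta>" by (rule L_less) (use elim \<alpha> in auto)
      finally show ?case .
    qed
  qed simp
  have U_sub_L: "prob {\<omega> \<in> space M. U \<omega> \<le> \<alpha>} \<le> prob {\<omega> \<in> space M. L \<omega> \<le> \<alpha>}" for \<alpha>
    using LU(2) by (intro finite_measure_mono) (auto intro: order_trans)
  have gap: "AE \<omega> in M. \<not> (L \<omega> \<le> \<alpha> \<and> \<alpha> < U \<omega>)" if \<alpha>: "0 < \<alpha>" "\<alpha> < b" for \<alpha>
  proof -
    have "{\<omega> \<in> space M. L \<omega> \<le> \<alpha> \<and> \<alpha> < U \<omega>} = {\<omega> \<in> space M. L \<omega> \<le> \<alpha>} - {\<omega> \<in> space M. U \<omega> \<le> \<alpha>}"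
      by auto
    also have "prob \<dots> = prob {\<omega> \<in> space M. L \<omega> \<le> \<alpha>} - prob {\<omega> \<in> space M. U \<omega> \<le> \<alpha>}"
      using LU(2) by (intro finite_measure_Diff) (auto intro: order_trans)
    also have "\<dots> \<le> 0" using L_le[of \<alpha>] U_le[OF \<alpha>] \<alpha> by simp
    finally have "prob {\<omega> \<in> space M. L \<omega> \<le> \<alpha> \<and> \<alpha> < U \<omega>} = 0"
      by (simp add: measure_le_0_iff)
    then show ?thesis
      by (intro AE_I[where N="{\<omega> \<in> space M. L \<omega> \<le> \<alpha> \<and> \<alpha> < U \<omega>}"]) (auto simp: emeasure_eq_measure)
  qed
  \<comment> \<open>Countably many levels suffice, since a rational lies strictly between
    \<open>L\<close> and \<open>U\<close> whenever they differ.\<close>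
  have "AE \<omega> in M. \<forall>q\<in>\<rat>. 0 < q \<and> q < b \<longrightarrow> \<not> (L \<omega> \<le> q \<and> q < U \<omega>)"
    by (subst AE_ball_countable[OF countable_rat]) (use gap in auto)
  then have lim: "AE \<omega> in M. (\<lambda>n. A n \<omega>) \<longlonglongrightarrow> L \<omega>"
  proof eventually_elim
    case (elim \<omega>)
    have "L \<omega> = U \<omega>"
    proof (rule ccontr)
      assume "L \<omega> \<noteq> U \<omega>"
      then have "L \<omega> < U \<omega>" using LU(2)[of \<omega>] by simp
      then obtain q where "q \<in> \<rat>" "L \<omega> < q" "q < U \<omega>" using Rats_dense_in_real by blast
      then show False using elim LU[of \<omega>] by force
    qed
    then have "(\<lambda>n. ereal (A n \<omega>)) \<longlonglongrightarrow> ereal (L \<omega>)"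
      using l[of \<omega>] u[of \<omega>] by (intro Liminf_eq_Limsup) (auto simp: l_def u_def)
    then show ?case by simp
  qed
  have "prob {\<omega> \<in> space M. L \<omega> \<le> \<alpha>} = F \<alpha>" if \<alpha>: "\<alpha> \<in> {0..b}" for \<alpha>
  proof -
    consider "\<alpha> = 0" | "\<alpha> = b" | "0 < \<alpha>" "\<alpha> < b" using \<alpha> by force
    then show ?thesis
    proof cases
      case 1
      then show ?thesis using L_le[of 0] b F(2) by (simp add: measure_le_0_iff)
    next
      case 2
      then have "{\<omega> \<in> space M. L \<omega> \<le> \<alpha>} = space M" using LU(2,3) by (auto intro: order_trans)
      then show ?thesis using 2 F(3) prob_space by simp
    next
      case 3
      then show ?thesis using L_le[of \<alpha>] U_le[of \<alpha>] U_sub_L[of \<alpha>] by simp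
    qed
  qed
  moreover have "L \<omega> \<in> {0..b}" for \<omega> using LU[of \<omega>] by simp
  ultimately show ?thesis using lim by (intro exI[of _ L]) auto
qed

text \<open>A derivative of the geometric series; the linear factor counts the possible endpoints of
  the greedy path at time \<open>Suc n\<close>.\<close>

lemma summable_linear_exp:
  fixes c :: real
  assumes "0 < c"
  shows "summable (\<lambda>n. real (n + 2) * (4 * exp (- c * real (Suc n))))"
proof -
  have "summable (\<lambda>n. of_nat (Suc n) * exp (- c) ^ n)"
    using geometric_deriv_sums[of "exp (- c)"] assms by (auto intro: sums_summable)
  then have "summable (\<lambda>n. 4 * (real (Suc (Suc n)) * exp (- c) ^ Suc n))"
    by (intro summable_mult) (subst summable_Suc_iff[where f="\<lambda>n. real (Suc n) * exp (- c) ^ n"])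
  moreover have "4 * (real (Suc (Suc n)) * exp (- c) ^ Suc n) = real (n + 2) * (4 * exp (- c * real (Suc n)))" for n
    by (simp only: exp_of_nat2_mult[symmetric]) simp
  ultimately show ?thesis by (simp only:)
qed

context exp_lpp
begin

definition below :: "real \<Rightarrow> nat \<Rightarrow> 'a set" where
  "below s n = {\<omega> \<in> space M. real_of_int (snd (comp_interface (W \<omega>) n)) \<le> s * real_of_int (fst (comp_interface (W \<omega>) n))}"

lemma below_event [measurable]: "below s n \<in> events"
proof -
  have "below s n = (\<lambda>\<omega>. comp_interface (W \<omega>) n) -` {z. real_of_int (snd z) \<le> s * real_of_int (fst z)} \<inter> space M"
    by (auto simp: below_def)
  also have "\<dots> \<in> events"
    by (rule measurable_sets[OF comp_interface_measurable]) auto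
  finally show ?thesis .
qed

text \<open>Outside the single event \<open>C\<close> the greedy path starts to the right and traps
  the interface at all times of the window. Each visit of the interface to the cone then makes a
  comparison fail at the greedy position.\<close>

lemma below_prob:
  assumes \<rho>: "0 < \<rho>" "\<rho> < \<sigma>" "\<sigma> < 1" and s: "s = ((1 - \<sigma>) / \<sigma>)\<^sup>2"
  obtains c where "0 < c"
    "\<And>N0 N1. prob (\<Union>n\<in>{N0..<N1}. below s n) \<le> (1 - \<rho>) + (\<Sum>n = N0..<N1. real (n + 2) * (4 * exp (- c * real (Suc n))))"
proof -
  obtain c where c: "0 < c" and bad: "\<And>N a b. a + b < N \<Longrightarrow> real b \<le> s * real a \<Longrightarrow>
      prob {\<omega> \<in> space M. stat_field N \<rho> \<omega> (1, 1) - stat_field N \<rho> \<omega> (1 + int a, 1 + int b)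
        \<le> stat_field N \<sigma> \<omega> (1, 1) - stat_field N \<sigma> \<omega> (1 + int a, 1 + int b)} \<le> 4 * exp (- c * real (a + b))"
    using stat_field_compare[OF assms] by blast
  have "prob (\<Union>n\<in>{N0..<N1}. below s n) \<le> (1 - \<rho>) + (\<Sum>n = N0..<N1. real (n + 2) * (4 * exp (- c * real (Suc n))))" for N0 N1
  proof -
    \<comment> \<open>The smallest box with \<open>Suc n < N\<close> for all \<open>n < N1\<close>,
      as \<open>busemann_crossing\<close> requires.\<close>
    define N where "N = Suc N1"
    define E where "E n a = {\<omega> \<in> space M.
       stat_field N \<rho> \<omega> (1, 1) - stat_field N \<rho> \<omega> (1 + int a, 1 + int (Suc n - a))
        \<le> stat_field N \<sigma> \<omega> (1, 1) - stat_field N \<sigma> \<omega> (1 + int a, 1 + int (Suc n - a))}" for n a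
    \<comment> \<open>The greedy position is random, whereas the deviation bound is for fixed
      points; hence a union over all points of the antidiagonal in the cone.\<close>
    define I where "I n = {a. a \<le> Suc n \<and> real (Suc n - a) \<le> s * real a}" for n
    define C where "C = {\<omega> \<in> space M. stat_field N \<rho> \<omega> (2, 1) < stat_field N \<rho> \<omega> (1, 2)}"
    have [measurable]: "E n a \<in> events" "C \<in> events" for n a unfolding E_def C_def by measurable
    have fin: "finite (I n)" for n unfolding I_def by (rule finite_subset[of _ "{..Suc n}"]) auto
    have "card (I n) \<le> card {..Suc n}" for n by (rule card_mono) (auto simp: I_def)
    then have card: "card (I n) \<le> n + 2" for n by simp
    have [measurable]: "(\<Union>a\<in>I n. E n a) \<in> events" for n using fin by auto
    have EI: "prob (\<Union>a\<in>I n. E n a) \<le> real (n + 2) * (4 * exp (- c * real (Suc n)))" if n: "n < N1" for n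
    proof -
      have "prob (\<Union>a\<in>I n. E n a) \<le> (\<Sum>a\<in>I n. prob (E n a))"
        using fin by (intro finite_measure_subadditive_finite) auto
      also have "\<dots> \<le> (\<Sum>a\<in>I n. 4 * exp (- c * real (Suc n)))"
      proof (rule sum_mono)
        fix a assume "a \<in> I n"
        then have a: "a \<le> Suc n" "real (Suc n - a) \<le> s * real a" by (auto simp: I_def)
        then have ab: "a + (Suc n - a) = Suc n" by simp
        show "prob (E n a) \<le> 4 * exp (- c * real (Suc n))"
          unfolding E_def by (rule bad[of a "Suc n - a" N, unfolded ab, OF _ a(2)]) (simp add: N_def n)
      qed
      also have "\<dots> \<le> real (n + 2) * (4 * exp (- c * real (Suc n)))"
        using card[of n] by (simp only: sum_constant) (intro mult_right_mono, auto)
      finally show ?thesis .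
    qed
    have "AE \<omega> in M. \<omega> \<in> (\<Union>n\<in>{N0..<N1}. below s n) \<longrightarrow> \<omega> \<in> C \<union> (\<Union>n\<in>{N0..<N1}. \<Union>a\<in>I n. E n a)"
      using no_ties AE_space
    proof eventually_elim
      case (elim \<omega>)
      show ?case
      proof
        assume "\<omega> \<in> (\<Union>n\<in>{N0..<N1}. below s n)"
        then obtain n where n: "N0 \<le> n" "n < N1" "\<omega> \<in> below s n" by auto
        let ?f = "fst (comp_interface (W \<omega>) n)"
        show "\<omega> \<in> C \<union> (\<Union>n\<in>{N0..<N1}. \<Union>a\<in>I n. E n a)"
        proof (cases "\<omega> \<in> C")
          case False
          then have "stat_field N \<rho> \<omega> (1, 2) \<le> stat_field N \<rho> \<omega> (2, 1)"
            using elim(2) by (simp add: C_def)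
          from busemann_crossing[OF busemann_stat_field busemann_stat_field[of \<omega> N \<sigma>] this, of n] elim(1) n
          obtain a b where ab: "a + b = Suc n" "?f \<le> int a"
            "stat_field N \<rho> \<omega> (1, 1) - stat_field N \<rho> \<omega> (1 + int a, 1 + int b)
              \<le> stat_field N \<sigma> \<omega> (1, 1) - stat_field N \<sigma> \<omega> (1 + int a, 1 + int b)"
            unfolding N_def by auto
          have "int b \<le> snd (comp_interface (W \<omega>) n)"
            using comp_interface_bounds[of "W \<omega>" n] ab(1,2) by linarith
          then have "real b \<le> real_of_int (snd (comp_interface (W \<omega>) n))" by linarith
          also have "\<dots> \<le> s * real_of_int ?f" using n(3) by (simp add: below_def)
          also have "\<dots> \<le> s * real a" using ab(2) s by (intro mult_left_mono) auto
          finally have "a \<in> I n" using ab(1) by (simp add: I_def flip: ab(1))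
          moreover have "\<omega> \<in> E n a" using ab elim(2) by (simp add: E_def flip: ab(1))
          ultimately show ?thesis using n by auto
        qed simp
      qed
    qed
    then have "prob (\<Union>n\<in>{N0..<N1}. below s n) \<le> prob (C \<union> (\<Union>n\<in>{N0..<N1}. \<Union>a\<in>I n. E n a))"
      by (rule finite_measure_mono_AE) auto
    also have "\<dots> \<le> prob C + prob (\<Union>n\<in>{N0..<N1}. \<Union>a\<in>I n. E n a)"
      by (rule measure_Un_le) auto
    also have "prob (\<Union>n\<in>{N0..<N1}. \<Union>a\<in>I n. E n a) \<le> (\<Sum>n = N0..<N1. prob (\<Union>a\<in>I n. E n a))"
      by (intro finite_measure_subadditive_finite) auto
    also have "\<dots> \<le> (\<Sum>n = N0..<N1. real (n + 2) * (4 * exp (- c * real (Suc n))))"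
      by (intro sum_mono EI) auto
    also have "prob C \<le> 1 - \<rho>"
      unfolding C_def by (rule stat_field_corner) (use \<rho> in \<open>auto simp: N_def\<close>)
    finally show ?thesis by simp
  qed
  with c show thesis by (rule that)
qed

text \<open>Three limits in turn: \<open>N1\<close> to infinity for fixed \<open>N0\<close>, then
  the tail error \<open>e\<close> to 0, then \<open>\<rho>\<close> up to
  \<open>\<sigma>\<close>.\<close>

lemma below_infinitely_often:
  assumes "0 < s"
  shows "prob {\<omega> \<in> space M. \<exists>\<^sub>F n in sequentially. \<omega> \<in> below s n} \<le> sqrt s / (1 + sqrt s)"
proof -
  define \<sigma> where "\<sigma> = 1 / (1 + sqrt s)"
  have \<sigma>: "0 < \<sigma>" "\<sigma> < 1" and s\<sigma>: "s = ((1 - \<sigma>) / \<sigma>)\<^sup>2" and goal: "sqrt s / (1 + sqrt s) = 1 - \<sigma>"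
  proof -
    define q where "q = sqrt s"
    have q: "0 < q" using assms by (simp add: q_def)
    show "0 < \<sigma>" "\<sigma> < 1" "sqrt s / (1 + sqrt s) = 1 - \<sigma>"
      unfolding \<sigma>_def q_def[symmetric] using q by (auto simp: field_simps)
    have "(1 - \<sigma>) / \<sigma> = sqrt s"
      unfolding \<sigma>_def q_def[symmetric] using q by (simp add: field_simps)
    then show "s = ((1 - \<sigma>) / \<sigma>)\<^sup>2" using assms by simp
  qed
  let ?I = "{\<omega> \<in> space M. \<exists>\<^sub>F n in sequentially. \<omega> \<in> below s n}"
  have main: "prob ?I \<le> (1 - \<rho>) + e" if \<rho>: "0 < \<rho>" "\<rho> < \<sigma>" and e: "0 < e" for \<rho> e
  proof -
    obtain c where c: "0 < c" "\<And>N0 N1. prob (\<Union>n\<in>{N0..<N1}. below s n) \<le>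
        (1 - \<rho>) + (\<Sum>n = N0..<N1. real (n + 2) * (4 * exp (- c * real (Suc n))))"
      using below_prob[OF \<rho> \<sigma>(2) s\<sigma>] by blast
    obtain N0 where N0: "\<And>N1. norm (\<Sum>n = N0..<N1. real (n + 2) * (4 * exp (- c * real (Suc n)))) < e"
      using summable_linear_exp[OF c(1)] e unfolding summable_Cauchy by blast
    have bound: "prob (\<Union>n\<in>{N0..<N1}. below s n) \<le> (1 - \<rho>) + e" for N1
      using c(2)[of N0 N1] N0[of N1] by (simp only: real_norm_def)
    have "(\<lambda>N1. prob (\<Union>n\<in>{N0..<N1}. below s n)) \<longlonglongrightarrow> prob (\<Union>N1. \<Union>n\<in>{N0..<N1}. below s n)"
    proof (rule finite_Lim_measure_incseq)
      show "incseq (\<lambda>N1. \<Union>n\<in>{N0..<N1}. below s n)" by (intro monoI UN_mono) auto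
    qed auto
    then have "prob (\<Union>N1. \<Union>n\<in>{N0..<N1}. below s n) \<le> (1 - \<rho>) + e"
      by (rule LIMSEQ_le_const2) (use bound in auto)
    moreover have "prob ?I \<le> prob (\<Union>N1. \<Union>n\<in>{N0..<N1}. below s n)"
    proof (rule finite_measure_mono)
      show "?I \<subseteq> (\<Union>N1. \<Union>n\<in>{N0..<N1}. below s n)"
      proof
        fix \<omega> assume "\<omega> \<in> ?I"
        then obtain n where "N0 \<le> n" "\<omega> \<in> below s n" by (auto simp: frequently_sequentially)
        then show "\<omega> \<in> (\<Union>N1. \<Union>n\<in>{N0..<N1}. below s n)" by (intro UN_I[of "Suc n"] UN_I[of n]) auto
      qed
    qed auto
    ultimately show ?thesis by simp
  qed
  have "prob ?I \<le> 1 - \<rho>" if "0 < \<rho>" "\<rho> < \<sigma>" for \<rho>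
    by (rule field_le_epsilon) (rule main[OF that])
  then have "\<rho> \<le> 1 - prob ?I" if "0 < \<rho>" "\<rho> < \<sigma>" for \<rho>
    using that by (simp only: le_diff_eq add.commute)
  then have "\<sigma> \<le> 1 - prob ?I"
    by (rule dense_le_bounded[OF \<sigma>(1)])
  then show ?thesis unfolding goal by linarith
qed

end

lemma (in exp_lpp) exp_lpp_swap: "exp_lpp M (\<lambda>z. w (prod.swap z))"
proof
  show "indep_vars (\<lambda>_. borel) (\<lambda>z. w (prod.swap z)) UNIV"
    using indep_vars_reindex[of prod.swap UNIV "\<lambda>_. borel" w] indep by simp
  show "distr M borel (w (prod.swap z)) = expM 1" for z by (rule law)
qed

context exp_lpp
begin

text \<open>The reflected weights form the same model, and their interface is below slope
  \<open>1 / s\<close> when the original one is above slope \<open>s\<close>.\<close>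

lemma above_infinitely_often:
  assumes "0 < s"
  shows "prob {\<omega> \<in> space M. \<exists>\<^sub>F n in sequentially.
      s * real_of_int (fst (comp_interface (W \<omega>) n)) \<le> real_of_int (snd (comp_interface (W \<omega>) n))} \<le> 1 / (1 + sqrt s)"
proof -
  interpret T: exp_lpp M "\<lambda>z. w (prod.swap z)" by (rule exp_lpp_swap)
  have "AE \<omega> in M. \<forall>n. comp_interface (\<lambda>z. w (prod.swap z) \<omega>) n = prod.swap (comp_interface (W \<omega>) n)"
    using no_ties
  proof eventually_elim
    case (elim \<omega>)
    then have "comp_interface (W \<omega> \<circ> prod.swap) n = prod.swap (comp_interface (W \<omega>) n)" for n
      by (intro comp_interface_swap) blast
    then show ?case by (simp add: comp_def)
  qed
  then have "AE \<omega> in M. \<omega> \<in> {\<omega> \<in> space M. \<exists>\<^sub>F n in sequentially.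
      s * real_of_int (fst (comp_interface (W \<omega>) n)) \<le> real_of_int (snd (comp_interface (W \<omega>) n))}
    \<longrightarrow> \<omega> \<in> {\<omega> \<in> space M. \<exists>\<^sub>F n in sequentially. \<omega> \<in> T.below (1 / s) n}"
  proof eventually_elim
    case (elim \<omega>)
    then show ?case using assms
      by (auto simp: T.below_def field_simps elim!: frequently_elim1)
  qed
  then have "prob {\<omega> \<in> space M. \<exists>\<^sub>F n in sequentially.
      s * real_of_int (fst (comp_interface (W \<omega>) n)) \<le> real_of_int (snd (comp_interface (W \<omega>) n))} \<le>
     prob {\<omega> \<in> space M. \<exists>\<^sub>F n in sequentially. \<omega> \<in> T.below (1 / s) n}"
    by (rule finite_measure_mono_AE) (simp add: frequently_sequentially)
  also have "\<dots> \<le> sqrt (1 / s) / (1 + sqrt (1 / s))"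
    by (rule T.below_infinitely_often) (use assms in simp)
  also have "\<dots> = 1 / (1 + sqrt s)"
    using assms by (simp add: real_sqrt_divide field_simps)
  finally show ?thesis .
qed

end

section \<open>From slopes to angles\<close>

lemma normalize_complex_eq_cis_arctan:
  assumes "0 < a"
  shows "Complex a b / of_real (cmod (Complex a b)) = cis (arctan (b / a))"
proof -
  define r where "r = sqrt (a\<^sup>2 + b\<^sup>2)"
  have r: "0 < r" using assms by (simp add: r_def add_pos_nonneg)
  have "1 + (b / a)\<^sup>2 = (a\<^sup>2 + b\<^sup>2) / a\<^sup>2" using assms by (simp add: field_simps power_divide)
  then have "sqrt (1 + (b / a)\<^sup>2) = r / a" using assms by (simp add: real_sqrt_divide r_def)
  then show ?thesis
    using assms r by (simp add: complex_eq_iff cos_arctan sin_arctan complex_norm r_def[symmetric])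
qed

text \<open>At slope \<open>tan \<alpha>\<close> the two frequency bounds become
  \<open>F \<alpha>\<close> and exactly \<open>1 - F \<alpha>\<close>, as
  \<open>converges_if_frequency_bounds\<close> demands.\<close>

lemma sqrt_tan_ratio:
  assumes "0 < \<alpha>" "\<alpha> < pi / 2"
  shows "sqrt (tan \<alpha>) / (1 + sqrt (tan \<alpha>)) = sqrt (sin \<alpha>) / (sqrt (sin \<alpha>) + sqrt (cos \<alpha>))"
    and "1 / (1 + sqrt (tan \<alpha>)) = 1 - sqrt (sin \<alpha>) / (sqrt (sin \<alpha>) + sqrt (cos \<alpha>))"
proof -
  define p q where "p = sqrt (sin \<alpha>)" and "q = sqrt (cos \<alpha>)"
  have pq: "0 < p" "0 < q"
    using assms sin_gt_zero[of \<alpha>] cos_gt_zero[of \<alpha>] by (auto simp: p_def q_def)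
  have t: "sqrt (tan \<alpha>) = p / q" by (simp add: tan_def real_sqrt_divide p_def q_def)
  show "sqrt (tan \<alpha>) / (1 + sqrt (tan \<alpha>)) = sqrt (sin \<alpha>) / (sqrt (sin \<alpha>) + sqrt (cos \<alpha>))"
    "1 / (1 + sqrt (tan \<alpha>)) = 1 - sqrt (sin \<alpha>) / (sqrt (sin \<alpha>) + sqrt (cos \<alpha>))"
    unfolding t p_def[symmetric] q_def[symmetric] using pq by (auto simp: field_simps)
qed

theorem theorem1:
  fixes M :: "'a measure" and w :: "int \<times> int \<Rightarrow> 'a \<Rightarrow> real"
  assumes "prob_space M"
    and "prob_space.indep_vars M (\<lambda>_. borel) w UNIV"
    and "\<And>z. distributed M lborel (w z) (\<lambda>x. ennreal (exponential_density 1 x))"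
  shows "\<exists>\<theta> :: 'a \<Rightarrow> real. \<theta> \<in> borel_measurable M \<and>
           (\<forall>\<omega>\<in>space M. \<theta> \<omega> \<in> {0 .. pi / 2}) \<and>
           (AE \<omega> in M. (\<lambda>n. to_complex (comp_interface (\<lambda>z. w z \<omega>) n)
                              / of_real (cmod (to_complex (comp_interface (\<lambda>z. w z \<omega>) n))))
                          \<longlonglongrightarrow> cis (\<theta> \<omega>)) \<and>
           (\<forall>\<alpha>\<in>{0 .. pi / 2}. measure M {\<omega> \<in> space M. \<theta> \<omega> \<le> \<alpha>} =
               sqrt (sin \<alpha>) / (sqrt (sin \<alpha>) + sqrt (cos \<alpha>)))"
proof -
  interpret prob_space M by fact
  interpret exp_lpp M w
  proof
    show "indep_vars (\<lambda>_. borel) w UNIV" by fact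
    show "distr M borel (w z) = expM 1" for z
    proof -
      have "distr M borel (w z) = distr M lborel (w z)" by (rule distr_cong) auto
      then show ?thesis using distributed_distr_eq_density[OF assms(3)[of z]] by simp
    qed
  qed
  let ?x = "\<lambda>n \<omega>. real_of_int (fst (comp_interface (W \<omega>) n))"
  let ?y = "\<lambda>n \<omega>. real_of_int (snd (comp_interface (W \<omega>) n))"
  let ?F = "\<lambda>\<alpha>. sqrt (sin \<alpha>) / (sqrt (sin \<alpha>) + sqrt (cos \<alpha>))"
  define A where "A n \<omega> = arctan (?y n \<omega> / ?x n \<omega>)" for n \<omega>
  have pos: "0 < ?x n \<omega>" "0 < ?y n \<omega>" for \<omega> n
    using comp_interface_bounds[of "W \<omega>" n] by auto
  have [measurable]: "(\<lambda>\<omega>. comp_interface (W \<omega>) n) \<in> measurable M (count_space UNIV)" for n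
    by (rule comp_interface_measurable) simp
  have meas: "A n \<in> borel_measurable M" for n
    unfolding A_def by measurable
  have bnd: "A n \<omega> \<in> {0..pi / 2}" for n \<omega>
    using pos[of \<omega> n] arctan_ubound[of "?y n \<omega> / ?x n \<omega>"] by (auto simp: A_def less_imp_le)
  have cont: "continuous_on {0..pi / 2} ?F"
  proof (intro continuous_intros ballI)
    fix \<alpha> assume \<alpha>: "\<alpha> \<in> {0..pi / 2}"
    have "0 \<le> sin \<alpha>" "0 \<le> cos \<alpha>" using \<alpha> by (auto intro: sin_ge_zero cos_ge_zero)
    moreover have "sin \<alpha> \<noteq> 0 \<or> cos \<alpha> \<noteq> 0" using sin_zero_abs_cos_one[of \<alpha>] by auto
    ultimately show "sqrt (sin \<alpha>) + sqrt (cos \<alpha>) \<noteq> 0"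
      by (simp add: add_nonneg_eq_0_iff)
  qed
  \<comment> \<open>Monotonicity of \<open>arctan\<close> and positivity of the coordinates turn
    angle bounds into the slope conditions of the two cone estimates.\<close>
  have le_iff: "A n \<omega> \<le> \<alpha> \<longleftrightarrow> ?y n \<omega> \<le> tan \<alpha> * ?x n \<omega>" "\<alpha> \<le> A n \<omega> \<longleftrightarrow> tan \<alpha> * ?x n \<omega> \<le> ?y n \<omega>"
    if "0 < \<alpha>" "\<alpha> < pi / 2" for n \<omega> \<alpha>
  proof -
    have "\<alpha> = arctan (tan \<alpha>)" using that by (simp add: arctan_tan)
    then have "A n \<omega> \<le> \<alpha> \<longleftrightarrow> ?y n \<omega> / ?x n \<omega> \<le> tan \<alpha>" "\<alpha> \<le> A n \<omega> \<longleftrightarrow> tan \<alpha> \<le> ?y n \<omega> / ?x n \<omega>"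
      unfolding A_def by (metis arctan_le_iff)+
    then show "A n \<omega> \<le> \<alpha> \<longleftrightarrow> ?y n \<omega> \<le> tan \<alpha> * ?x n \<omega>" "\<alpha> \<le> A n \<omega> \<longleftrightarrow> tan \<alpha> * ?x n \<omega> \<le> ?y n \<omega>"
      using pos(1)[of \<omega> n] by (simp_all add: divide_le_eq le_divide_eq)
  qed
  have tan_pos: "0 < tan \<alpha>" if "0 < \<alpha>" "\<alpha> < pi / 2" for \<alpha> :: real
    using that by (rule tan_gt_zero)
  have lo: "prob {\<omega> \<in> space M. \<exists>\<^sub>F n in sequentially. A n \<omega> \<le> \<alpha>} \<le> ?F \<alpha>" if \<alpha>: "0 < \<alpha>" "\<alpha> < pi / 2" for \<alpha>
  proof -
    have "{\<omega> \<in> space M. \<exists>\<^sub>F n in sequentially. A n \<omega> \<le> \<alpha>} =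
       {\<omega> \<in> space M. \<exists>\<^sub>F n in sequentially. \<omega> \<in> below (tan \<alpha>) n}"
      by (auto simp: le_iff[OF \<alpha>] below_def)
    then show ?thesis
      using below_infinitely_often[OF tan_pos[OF \<alpha>]] unfolding sqrt_tan_ratio(1)[OF \<alpha>] by simp
  qed
  have hi: "prob {\<omega> \<in> space M. \<exists>\<^sub>F n in sequentially. \<alpha> \<le> A n \<omega>} \<le> 1 - ?F \<alpha>" if \<alpha>: "0 < \<alpha>" "\<alpha> < pi / 2" for \<alpha>
    using above_infinitely_often[OF tan_pos[OF \<alpha>]] unfolding sqrt_tan_ratio(2)[OF \<alpha>] le_iff(2)[OF \<alpha>] .
  obtain \<theta> where \<theta>: "\<theta> \<in> borel_measurable M" "\<And>\<omega>. \<theta> \<omega> \<in> {0..pi / 2}"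
    "AE \<omega> in M. (\<lambda>n. A n \<omega>) \<longlonglongrightarrow> \<theta> \<omega>" "\<forall>\<alpha>\<in>{0..pi / 2}. prob {\<omega> \<in> space M. \<theta> \<omega> \<le> \<alpha>} = ?F \<alpha>"
    using converges_if_frequency_bounds[OF meas bnd cont _ _ lo hi] by auto
  have "AE \<omega> in M. (\<lambda>n. to_complex (comp_interface (W \<omega>) n) / of_real (cmod (to_complex (comp_interface (W \<omega>) n))))
      \<longlonglongrightarrow> cis (\<theta> \<omega>)"
    using \<theta>(3)
  proof eventually_elim
    case (elim \<omega>)
    have "to_complex (comp_interface (W \<omega>) n) / of_real (cmod (to_complex (comp_interface (W \<omega>) n))) = cis (A n \<omega>)" for n
      unfolding to_complex_def A_def by (rule normalize_complex_eq_cis_arctan) (rule pos)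
    moreover have "(\<lambda>n. cis (A n \<omega>)) \<longlonglongrightarrow> cis (\<theta> \<omega>)"
      unfolding cis_conv_exp using elim by (intro tendsto_intros)
    ultimately show ?case by (simp only:)
  qed
  with \<theta> show ?thesis by (intro exI[of _ \<theta>]) auto
qed

end
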